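(* Let $T$ be a tree on $n$ vertices with matching number $\beta$. Then $$H(T)\le \frac{1}{24}\left(6n^2-4\beta n+\beta^2+9\beta+10n-22\right),$$ with equality if and only if $T\cong A_{n,n-\beta}$.
   Context: The Harary index of a connected graph $G$ is $H(G)=\sum_{\{x,y\}\subseteq V(G),\,x\ne y}\frac{1}{d(x,y)}$, $d$ the shortest-path distance. The matching number of $G$ is the maximum number of pairwise vertex-disjoint edges. For $\frac{n-1}{2}\le m\le n-1$, the spur $A_{n,m}$ is the tree obtained from the star $S_{m+1}$ by adding a pendent edge to each of $n-m-1$ of its pendent vertices.
   Formalization: The tree is assumed to have n ≥ 2 vertices; for the one-vertex tree (n = 1, β = 0) the stated bound is −1/4 while H = 0, so the claim fails, and the spur A_{1,1} is undefined. *)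

theory Defs
  imports Graph_Theory.Graph_Theory
begin

text \<open>
  A finite simple graph is a \<^locale>\<open>pair_graph\<close>: a finite, loopless, symmetric digraph without
  parallel arcs, in which each undirected edge \<open>{u, v}\<close> is represented by the two arcs
  \<open>(u, v)\<close> and \<open>(v, u)\<close>.
\<close>

text \<open>
  The library predicate \<^const>\<open>tree\<close> is not usable here: for \<^const>\<open>pre_digraph.cycle\<close> the closed
  walk \<open>[(u, v), (v, u)]\<close> is a cycle, so no symmetric digraph with an edge is a \<^const>\<open>forest\<close>.
  Cycles of the underlying simple graph are those of length at least 3.
\<close>

definition simple_tree :: "'a pair_pre_digraph \<Rightarrow> bool" where
  "simple_tree G \<longleftrightarrow>
     pair_graph G \<and>
     Digraph_Component.connected (with_proj G) \<and>
     \<not> (\<exists>p. pre_digraph.cycle (with_proj G) p \<and> length p \<ge> 3)"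

definition path_dist :: "'a pair_pre_digraph \<Rightarrow> 'a \<Rightarrow> 'a \<Rightarrow> nat" where
  "path_dist G u v = (LEAST k. \<exists>p. pre_digraph.apath (with_proj G) u p v \<and> length p = k)"

text \<open>The factor 1/2 is there because the sum visits each unordered pair \<open>{x, y}\<close> twice.\<close>

definition harary_index :: "'a pair_pre_digraph \<Rightarrow> real" where
  "harary_index G =
     (\<Sum>x\<in>pverts G. \<Sum>y\<in>pverts G - {x}. 1 / real (path_dist G x y)) / 2"

definition uedges :: "'a pair_pre_digraph \<Rightarrow> 'a set set" where
  "uedges G = {{u, v} | u v. (u, v) \<in> parcs G}"

definition is_matching :: "'a pair_pre_digraph \<Rightarrow> 'a set set \<Rightarrow> bool" where
  "is_matching G M \<longleftrightarrow> M \<subseteq> uedges G \<and> pairwise disjnt M"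

definition matching_number :: "'a pair_pre_digraph \<Rightarrow> nat" where
  "matching_number G = Max (card ` {M. is_matching G M})"

text \<open>
  The spur $A_{n,m}$, for $(n-1)/2 \le m \le n-1$: the centre of the star $S_{m+1}$ is \<open>0\<close>, its
  pendent vertices are \<open>1, \<dots>, m\<close>, and the vertices \<open>m + 1, \<dots>, n - 1\<close> are the new endpoints
  of the pendent edges added at \<open>1, \<dots>, n - m - 1\<close>.
\<close>

definition spur :: "nat \<Rightarrow> nat \<Rightarrow> nat pair_pre_digraph" where
  "spur n m =
     (let E = {(0, i) | i. 1 \<le> i \<and> i \<le> m} \<union> {(i, m + i) | i. 1 \<le> i \<and> i \<le> n - m - 1}
      in \<lparr> pverts = {0..<n}, parcs = E \<union> E\<inverse> \<rparr>)"

end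

theory Submission
  imports Defs
begin

text \<open>
  Induction on the number of vertices. A tree with at least 3 vertices has two leaves \<open>u\<close>, \<open>u'\<close> at a
  common vertex \<open>v\<close>, or a leaf \<open>u\<close> whose neighbour \<open>v\<close> has degree 2, with second neighbour \<open>w\<close>.
  In the first case deleting \<open>u\<close> keeps the matching number; in the second case deleting \<open>u\<close> and \<open>v\<close>
  lowers it by one. The reciprocal distances lost are estimated through the degree of \<open>c\<close>, where \<open>c\<close>
  is \<open>v\<close> respectively \<open>w\<close>, and the estimate is exactly the required decrement because \<open>deg c \<le> n - \<beta>\<close>: no matching edge has both ends in the neighbourhood of \<open>c\<close>. Equality forces
  \<open>deg c = n - \<beta>\<close> and every vertex to lie within distance 2 of \<open>c\<close>, and the only such tree with
  matching number \<open>\<beta>\<close> is the spur. Conversely, the explicit distances in a spur attain the bound.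
\<close>

section \<open>Trees grown by adding leaves\<close>

text \<open>With \<open>d\<close> for the degree of \<open>c\<close>, the lost reciprocals sum to at
  most n/3 + d/6 + 1/6 for one of two leaves at a common vertex, and to at most 7n/12 + d/4 + 1/2
  for the two vertices of a pendant path. Both grow with \<open>d\<close>, so the worst case is d =
  n - \<beta>; twice the values there, for ordered pairs, are exactly the differences of the doubled
  quadratic bound. Slack in any single deletion excludes equality, so the deletion from the given
  tree already exhibits the centre. For the converse the distances of a spur are bounded only from
  above; the general upper bound turns the resulting lower bound on the sum into equality. The
  counting works on a vertex set with a symmetric arc relation grown leaf by leaf. Acyclicity is
  then consumed through triangle-freeness, the arc count and the two leaf configurations, and cycles
  in the sense of the library occur only when a given tree is shown to be grown.\<close>

inductive grown_tree :: "'a set \<Rightarrow> ('a \<times> 'a) set \<Rightarrow> bool" where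
  single: "grown_tree {a} {}"
| add_leaf: "grown_tree V E \<Longrightarrow> y \<in> V \<Longrightarrow> x \<notin> V \<Longrightarrow> grown_tree (insert x V) (E \<union> {(x, y), (y, x)})"

lemma grown_tree_finite: "grown_tree V E \<Longrightarrow> finite V"
  by (induction rule: grown_tree.induct) auto

lemma grown_tree_nonempty: "grown_tree V E \<Longrightarrow> V \<noteq> {}"
  by (induction rule: grown_tree.induct) auto

lemma grown_tree_edges: "grown_tree V E \<Longrightarrow> E \<subseteq> V \<times> V"
  by (induction rule: grown_tree.induct) auto

lemma grown_tree_edgeD: "grown_tree V E \<Longrightarrow> (x, y) \<in> E \<Longrightarrow> x \<in> V \<and> y \<in> V"
  using grown_tree_edges by fastforce

lemma grown_tree_finite_edges: "grown_tree V E \<Longrightarrow> finite E"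
  using grown_tree_edges grown_tree_finite by (metis finite_SigmaI finite_subset)

lemma grown_tree_sym: "grown_tree V E \<Longrightarrow> sym E"
  by (induction rule: grown_tree.induct) (auto simp: sym_def)

lemma grown_tree_symD: "grown_tree V E \<Longrightarrow> (x, y) \<in> E \<Longrightarrow> (y, x) \<in> E"
  by (meson grown_tree_sym symD)

lemma grown_tree_irrefl: "grown_tree V E \<Longrightarrow> (x, x) \<notin> E"
  by (induction rule: grown_tree.induct) auto

text \<open>\<open>E\<close> holds both orientations of every edge, so this is the count of n - 1
  edges without truncated subtraction. It serves later to show that a known set of arcs is all of
  \<open>E\<close>.\<close>

lemma grown_tree_card_edges: "grown_tree V E \<Longrightarrow> card E + 2 = 2 * card V"
proof (induction rule: grown_tree.induct)
  case (add_leaf V E y x)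
  have "finite E" "finite V" "(x, y) \<notin> E" "(y, x) \<notin> E" "x \<noteq> y"
    using add_leaf.hyps grown_tree_finite_edges[OF add_leaf.hyps(1)] grown_tree_finite[OF add_leaf.hyps(1)]
      grown_tree_edgeD[OF add_leaf.hyps(1)] by blast+
  then show ?case using add_leaf by simp
qed simp

lemma grown_tree_connected: "grown_tree V E \<Longrightarrow> x \<in> V \<Longrightarrow> y \<in> V \<Longrightarrow> (x, y) \<in> E\<^sup>*"
proof (induction arbitrary: x y rule: grown_tree.induct)
  case (add_leaf V E b a)
  let ?F = "E \<union> {(a, b), (b, a)}"
  have V: "(x, y) \<in> ?F\<^sup>*" if "x \<in> V" "y \<in> V" for x y
    using add_leaf.IH[OF that] rtrancl_mono[of E ?F] by auto
  have "(a, b) \<in> ?F" "(b, a) \<in> ?F" by auto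
  then have "(a, z) \<in> ?F\<^sup>* \<and> (z, a) \<in> ?F\<^sup>*" if "z \<in> V" for z
    using V[OF that \<open>b \<in> V\<close>] V[OF \<open>b \<in> V\<close> that]
    by (meson converse_rtrancl_into_rtrancl rtrancl.rtrancl_into_rtrancl)
  then show ?case using add_leaf.prems V by auto
qed simp

text \<open>The vertex added last has a single neighbour, while a corner of a triangle has
  two.\<close>

lemma grown_tree_triangle_free:
  "grown_tree V E \<Longrightarrow> (x, y) \<in> E \<Longrightarrow> (x, z) \<in> E \<Longrightarrow> (y, z) \<notin> E"
proof (induction arbitrary: x y z rule: grown_tree.induct)
  case (add_leaf V E b a)
  have "(a, t) \<notin> E" "(t, a) \<notin> E" "(t, t) \<notin> E" for t
    using grown_tree_edgeD[OF add_leaf.hyps(1)] grown_tree_irrefl[OF add_leaf.hyps(1)] add_leaf.hyps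
    by blast+
  moreover have "a \<noteq> b" using add_leaf.hyps by blast
  moreover have "(x, y) \<notin> E \<or> (x, z) \<notin> E \<or> (y, z) \<notin> E" using add_leaf.IH by metis
  ultimately show ?case using add_leaf.prems by auto
qed simp

text \<open>A leaf need not be the vertex added last, so the construction is reordered:
  \<open>u\<close> is dropped from the earlier tree and the last leaf attached again. The exception
  is a \<open>u\<close> that carries this last leaf itself.\<close>

lemma grown_tree_remove_leaf:
  "grown_tree V E \<Longrightarrow> E `` {u} = {v} \<Longrightarrow> grown_tree (V - {u}) (E - {(u, v), (v, u)})"
proof (induction arbitrary: v rule: grown_tree.induct)
  case (add_leaf V E b a)
  note * = grown_tree_edgeD[OF add_leaf.hyps(1)]
  consider "u = a" | "u = b" "u \<noteq> a" | "u \<noteq> a" "u \<noteq> b" by auto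
  then show ?case
  proof cases
    case 1
    then have "v = b" using add_leaf.prems by auto
    moreover have "insert a V - {u} = V" using 1 add_leaf.hyps by auto
    moreover have "E \<union> {(a, b), (b, a)} - {(u, v), (v, u)} = E"
      using * 1 \<open>v = b\<close> add_leaf.hyps by auto
    ultimately show ?thesis using add_leaf.hyps by simp
  next
    case 2
    \<comment> \<open>Even with the new leaf \<open>u\<close> has one neighbour only, so it was
      isolated before, and by connectedness the earlier tree was the single vertex
      \<open>b\<close>.\<close>
    have "v = a" using 2 add_leaf.prems by auto
    have "E `` {b} \<subseteq> {v}" using 2 add_leaf.prems by blast
    moreover have "a \<notin> E `` {b}" using * add_leaf.hyps(3) by blast
    ultimately have "E `` {b} = {}" using \<open>v = a\<close> by blast
    have "V = {b}"
    proof -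
      have "y = b" if "y \<in> V" for y
        using grown_tree_connected[OF add_leaf.hyps(1,2) that]
        by (cases rule: converse_rtranclE) (use \<open>E `` {b} = {}\<close> in auto)
      then show ?thesis using \<open>b \<in> V\<close> by blast
    qed
    then have "E = {}" using grown_tree_edges[OF add_leaf.hyps(1)] \<open>E `` {b} = {}\<close> by blast
    then have "insert a V - {u} = {a}" "E \<union> {(a, b), (b, a)} - {(u, v), (v, u)} = {}"
      using 2 \<open>V = {b}\<close> \<open>v = a\<close> by auto
    then show ?thesis using grown_tree.single by metis
  next
    case 3
    have "E `` {u} = {v}" using add_leaf.prems 3 by auto
    then have "grown_tree (V - {u}) (E - {(u, v), (v, u)})" by (rule add_leaf.IH)
    then have "grown_tree (insert a (V - {u})) ((E - {(u, v), (v, u)}) \<union> {(a, b), (b, a)})"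
      using add_leaf.hyps 3 by (intro grown_tree.add_leaf) auto
    moreover have "insert a (V - {u}) = insert a V - {u}" using 3 by auto
    moreover have "(E - {(u, v), (v, u)}) \<union> {(a, b), (b, a)} = E \<union> {(a, b), (b, a)} - {(u, v), (v, u)}"
      using 3 by blast
    ultimately show ?thesis by simp
  qed
qed simp

text \<open>The small cases are listed so that the induction closes. A leaf attached to one of two
  twin leaves creates a pendant path, one attached to the middle of a pendant path creates twin
  leaves, and one attached to its end shifts the path outwards. A path on three vertices counts as
  twin leaves; \<open>4 \<le> card V\<close> ensures that two vertices remain after two
  deletions.\<close>

lemma grown_tree_pendant_aux:
  "grown_tree V E \<Longrightarrow>
     (\<exists>a. V = {a} \<and> E = {}) \<or>
     (\<exists>a b. a \<noteq> b \<and> V = {a, b} \<and> E = {(a, b), (b, a)}) \<or>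
     (\<exists>u u' v. 3 \<le> card V \<and> u \<noteq> u' \<and> E `` {u} = {v} \<and> E `` {u'} = {v}) \<or>
     (\<exists>u v w. 4 \<le> card V \<and> u \<noteq> w \<and> E `` {u} = {v} \<and> E `` {v} = {u, w})"
  (is "_ \<Longrightarrow> ?A V E \<or> ?B V E \<or> ?C V E \<or> ?D V E")
proof (induction rule: grown_tree.induct)
  case (add_leaf V E y x)
  let ?V = "insert x V" and ?E = "E \<union> {(x, y), (y, x)}"
  note * = grown_tree_edgeD[OF add_leaf.hyps(1)]
  have x: "?E `` {x} = {y}" using * add_leaf.hyps by auto
  have E: "?E `` {z} = (if z = y then insert x (E `` {z}) else E `` {z})" if "z \<noteq> x" for z
    using that by auto
  have E0: "E `` {x} = {}" using * add_leaf.hyps by auto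
  have cV: "card ?V = Suc (card V)" using grown_tree_finite[OF add_leaf.hyps(1)] add_leaf.hyps(3) by simp
  have C: ?case if "3 \<le> card ?V" "u \<noteq> u'" "?E `` {u} = {v}" "?E `` {u'} = {v}" for u u' v
    by (rule disjI2, rule disjI2, rule disjI1, rule exI[of _ u], rule exI[of _ u'], rule exI[of _ v],
        intro conjI that)
  have D: ?case if "4 \<le> card ?V" "u \<noteq> w" "?E `` {u} = {v}" "?E `` {v} = {u, w}" for u v w
    by (rule disjI2, rule disjI2, rule disjI2, rule exI[of _ u], rule exI[of _ v], rule exI[of _ w],
        intro conjI that)
  from add_leaf.IH show ?case
  proof (elim disjE)
    assume "?A V E"
    then obtain a where "V = {a}" "E = {}" by (elim exE conjE)
    then have "x \<noteq> y" "?V = {x, y}" "?E = {(x, y), (y, x)}" using add_leaf.hyps by simp_all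
    then have "?B ?V ?E" by metis
    then show ?thesis by (intro disjI2 disjI1)
  next
    assume "?B V E"
    then obtain a b where ab: "a \<noteq> b" "V = {a, b}" "E = {(a, b), (b, a)}" by blast
    \<comment> \<open>The end of the old edge other than \<open>y\<close>: on the path
      \<open>c\<close>, \<open>y\<close>, \<open>x\<close> both ends are leaves at
      \<open>y\<close>.\<close>
    define c where "c = (if y = a then b else a)"
    have c: "E `` {c} = {y}" "c \<noteq> x" "c \<noteq> y" using add_leaf.hyps ab unfolding c_def by auto
    have "3 \<le> card ?V" using cV ab by simp
    moreover have "?E `` {c} = {y}" using E c by simp
    ultimately show ?thesis by (rule C[OF _ c(2) _ x])
  next
    assume "?C V E"
    then obtain u u' v where uv: "3 \<le> card V" "u \<noteq> u'" "E `` {u} = {v}" "E `` {u'} = {v}"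
      by (elim exE conjE)
    have ne: "u \<noteq> x" "u' \<noteq> x" using uv E0 by auto
    have v: "(u, v) \<in> E" "(u', v) \<in> E" using uv by blast+
    have ne': "x \<noteq> v" using v * add_leaf.hyps by metis
    have 4: "4 \<le> card ?V" and 3: "3 \<le> card ?V" using uv cV by simp_all
    consider "y = u" | "y = u'" | "y \<noteq> u" "y \<noteq> u'" by metis
    then show ?thesis
    proof cases
      case 1
      then have "?E `` {u} = {x, v}" using E ne uv by simp
      then show ?thesis by (rule D[OF 4 ne', rotated]) (use x 1 in simp)
    next
      case 2
      then have "?E `` {u'} = {x, v}" using E ne uv by simp
      then show ?thesis by (rule D[OF 4 ne', rotated]) (use x 2 in simp)
    next
      case 3
      have "?E `` {u} = {v}" "?E `` {u'} = {v}" using E ne uv 3 by metis+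
      then show ?thesis by (rule C[OF \<open>3 \<le> card ?V\<close> uv(2)])
    qed
  next
    assume "?D V E"
    then obtain u v w where uv: "4 \<le> card V" "u \<noteq> w" "E `` {u} = {v}" "E `` {v} = {u, w}"
      by (elim exE conjE)
    have ne: "u \<noteq> x" "v \<noteq> x" using uv E0 by auto
    have "(u, v) \<in> E" using uv by blast
    then have ne': "v \<noteq> u" using grown_tree_irrefl[OF add_leaf.hyps(1)] by metis
    have 4: "4 \<le> card ?V" and 3: "3 \<le> card ?V" using uv cV by simp_all
    consider "y = u" | "y = v" | "y \<noteq> u" "y \<noteq> v" by metis
    then show ?thesis
    proof cases
      case 1
      then have "?E `` {u} = {x, v}" using E ne uv by simp
      then show ?thesis by (rule D[OF 4 ne(2)[symmetric], rotated]) (use x 1 in simp)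
    next
      case 2
      then have "?E `` {u} = {v}" using E ne uv ne' by simp
      then show ?thesis by (rule C[OF 3 ne(1)]) (use x 2 in simp)
    next
      case 3
      have "?E `` {u} = {v}" "?E `` {v} = {u, w}" using E ne uv 3 by metis+
      then show ?thesis by (rule D[OF 4 uv(2)])
    qed
  qed
qed simp

lemma grown_tree_pendant_cases:
  assumes "grown_tree V E" "3 \<le> card V"
  obtains (cherry) u u' v where "u \<noteq> u'" "E `` {u} = {v}" "E `` {u'} = {v}"
  | (path) u v w where "4 \<le> card V" "u \<noteq> w" "E `` {u} = {v}" "E `` {v} = {u, w}"
  using grown_tree_pendant_aux[OF assms(1)]
proof (elim disjE exE conjE)
  fix a assume "V = {a}" then show ?thesis using assms(2) by simp
next
  fix a b assume "a \<noteq> b" "V = {a, b}" then show ?thesis using assms(2) by simp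
next
  fix u u' v assume "u \<noteq> u'" "E `` {u} = {v}" "E `` {u'} = {v}" then show ?thesis by (rule cherry)
next
  fix u v w assume "4 \<le> card V" "u \<noteq> w" "E `` {u} = {v}" "E `` {v} = {u, w}"
  then show ?thesis by (rule path)
qed

lemma grown_tree_card_2:
  assumes "grown_tree V E" "card V = 2"
  obtains a b where "a \<noteq> b" "V = {a, b}" "E = {(a, b), (b, a)}"
  using grown_tree_pendant_aux[OF assms(1)]
proof (elim disjE exE conjE)
  fix a assume "V = {a}" then show ?thesis using assms(2) by simp
next
  fix a b assume "a \<noteq> b" "V = {a, b}" "E = {(a, b), (b, a)}" then show ?thesis by (rule that)
next
  assume "3 \<le> card V" then show ?thesis using assms(2) by simp
next
  assume "4 \<le> card V" then show ?thesis using assms(2) by simp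
qed

section \<open>Distances\<close>

text \<open>The reflexive closure admits stationary steps, so \<open>(x, y) \<in> (E\<^sup>=) ^^ k\<close> says that the distance is
  at most \<open>k\<close>.\<close>

definition rdist :: "('a \<times> 'a) set \<Rightarrow> 'a \<Rightarrow> 'a \<Rightarrow> nat" where
  "rdist E x y = (LEAST k. (x, y) \<in> (E\<^sup>=) ^^ k)"

lemma refl_relpow_mono: "(x, y) \<in> (E\<^sup>=) ^^ k \<Longrightarrow> k \<le> l \<Longrightarrow> (x, y) \<in> (E\<^sup>=) ^^ l"
proof (induction l)
  case (Suc l)
  then show ?case by (cases "k = Suc l") auto
qed simp

lemma refl_relpow_rdist:
  assumes "(x, y) \<in> E\<^sup>*"
  shows "(x, y) \<in> (E\<^sup>=) ^^ rdist E x y"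
proof -
  have "(x, y) \<in> (E\<^sup>=)\<^sup>*" using assms by simp
  then obtain k where "(x, y) \<in> (E\<^sup>=) ^^ k" using rtrancl_power by metis
  then show ?thesis unfolding rdist_def by (rule LeastI)
qed

lemma rdist_leI: "(x, y) \<in> (E\<^sup>=) ^^ k \<Longrightarrow> rdist E x y \<le> k"
  unfolding rdist_def by (rule Least_le)

lemma rdist_le_iff:
  assumes "(x, y) \<in> E\<^sup>*"
  shows "rdist E x y \<le> k \<longleftrightarrow> (x, y) \<in> (E\<^sup>=) ^^ k"
  by (rule iffI, erule refl_relpow_mono[OF refl_relpow_rdist[OF assms]], erule rdist_leI)

lemma refl_relpow_sym: "sym E \<Longrightarrow> (x, y) \<in> (E\<^sup>=) ^^ k \<Longrightarrow> (y, x) \<in> (E\<^sup>=) ^^ k"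
proof (induction k arbitrary: y)
  case (Suc k)
  obtain s where "(x, s) \<in> (E\<^sup>=) ^^ k" "(s, y) \<in> E\<^sup>="
    using Suc.prems(2) by (rule relpow_Suc_E)
  moreover from this(2) have "(y, s) \<in> E\<^sup>=" using \<open>sym E\<close> by (auto dest: symD)
  ultimately show ?case using Suc.IH[OF \<open>sym E\<close>] by (blast intro: relpow_Suc_I2)
qed simp

lemma rdist_sym:
  assumes "sym E"
  shows "rdist E x y = rdist E y x"
proof -
  have "(x, y) \<in> (E\<^sup>=) ^^ k \<longleftrightarrow> (y, x) \<in> (E\<^sup>=) ^^ k" for k
    by (rule iffI) (erule refl_relpow_sym[OF assms])+
  then show ?thesis by (simp only: rdist_def)
qed

lemma refl_relpow_2: "(x, y) \<in> (E\<^sup>=) ^^ 2 \<longleftrightarrow> x = y \<or> (x, y) \<in> E \<or> (\<exists>z. (x, z) \<in> E \<and> (z, y) \<in> E)"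
  by (auto simp: numeral_2_eq_2 relcomp_unfold)

lemma rdist_pos:
  assumes "(x, y) \<in> E\<^sup>*" "x \<noteq> y"
  shows "1 \<le> rdist E x y"
  using rdist_le_iff[OF assms(1), of 0] assms(2) by auto

lemma rdist_ge_2:
  assumes "(x, y) \<in> E\<^sup>*" "x \<noteq> y" "(x, y) \<notin> E"
  shows "2 \<le> rdist E x y"
  using rdist_le_iff[OF assms(1), of 1] assms(2,3) by auto

text \<open>A walk can leave \<open>u\<close> only towards \<open>v\<close>, so \<open>k + 1\<close>
  steps reach only \<open>u\<close> and vertices within \<open>k\<close> of \<open>v\<close>. A
  vertex farther than \<open>k\<close> from \<open>v\<close> therefore needs at least
  \<open>k + 2\<close> steps from \<open>u\<close>.\<close>

lemma rdist_leaf_gt: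
  assumes "(u, y) \<in> E\<^sup>*" "E `` {u} = {v}" "y \<noteq> u" "(v, y) \<notin> (E\<^sup>=) ^^ k"
  shows "k + 2 \<le> rdist E u y"
proof -
  have "(v, z) \<in> (E\<^sup>=) ^^ k \<or> z = u" if "(u, z) \<in> (E\<^sup>=) ^^ Suc k" for z k
    using that
  proof (induction k arbitrary: z)
    case 0
    then show ?case using assms(2) by auto
  next
    case (Suc k)
    obtain t where t: "(u, t) \<in> (E\<^sup>=) ^^ Suc k" "(t, z) \<in> E\<^sup>="
      using Suc.prems by (rule relpow_Suc_E)
    from Suc.IH[OF t(1)] show ?case
    proof
      assume "(v, t) \<in> (E\<^sup>=) ^^ k"
      then have "(v, z) \<in> (E\<^sup>=) ^^ Suc k" using t(2) by (blast intro: relpow_Suc_I)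
      then show ?thesis by simp
    next
      assume "t = u"
      then have "z = u \<or> z = v" using t(2) assms(2) by auto
      then show ?thesis using refl_relpow_mono[where x = v and y = v and k = 0 and l = "Suc k" and E = E] by auto
    qed
  qed
  then have "(u, y) \<notin> (E\<^sup>=) ^^ Suc k" using assms(3,4) by blast
  then have "\<not> rdist E u y \<le> Suc k" using rdist_le_iff[OF assms(1)] by blast
  then show ?thesis by simp
qed

lemma rdist_remove_leaf:
  assumes "(x, y) \<in> E\<^sup>*" "E `` {u} = {v}" "sym E" "x \<noteq> u" "y \<noteq> u"
  shows "rdist (E - {(u, v), (v, u)}) x y \<le> rdist E x y"
proof -
  let ?F = "E - {(u, v), (v, u)}"
  \<comment> \<open>folding the leaf onto its neighbour does not lengthen walks\<close>
  define f where "f z = (if z = u then v else z)" for z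
  have step: "(f z, f t) \<in> ?F\<^sup>=" if "(z, t) \<in> E\<^sup>=" for z t
    using that assms(2) \<open>sym E\<close> by (auto simp: f_def dest: symD)
  have "(f z, f t) \<in> (?F\<^sup>=) ^^ k" if "(z, t) \<in> (E\<^sup>=) ^^ k" for z t k
    using that
  proof (induction k arbitrary: t)
    case (Suc k)
    obtain s where "(z, s) \<in> (E\<^sup>=) ^^ k" "(s, t) \<in> E\<^sup>="
      using Suc.prems by (rule relpow_Suc_E)
    then show ?case using Suc.IH step by (blast intro: relpow_Suc_I)
  qed simp
  from this[OF refl_relpow_rdist[OF assms(1)]] show ?thesis
    using assms(4,5) by (intro rdist_leI) (simp add: f_def)
qed

section \<open>Sums of reciprocal distances and their loss when a leaf is deleted\<close>

definition recip_sum :: "'a set \<Rightarrow> ('a \<times> 'a) set \<Rightarrow> 'a \<Rightarrow> real" where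
  "recip_sum V E x = (\<Sum>y\<in>V - {x}. 1 / real (rdist E x y))"

text \<open>Twice the Harary index, as every pair is counted in both orders.\<close>

definition harary2 :: "'a set \<Rightarrow> ('a \<times> 'a) set \<Rightarrow> real" where
  "harary2 V E = (\<Sum>x\<in>V. recip_sum V E x)"

text \<open>The pairs containing \<open>u\<close> occur in both orders, whence the factor 2; on all
  other pairs the smaller tree has distances that are no larger, hence reciprocals that are no
  smaller.\<close>

lemma harary2_remove_leaf:
  assumes "grown_tree V E" "E `` {u} = {v}"
  shows "harary2 V E \<le> harary2 (V - {u}) (E - {(u, v), (v, u)}) + 2 * recip_sum V E u"
proof -
  let ?F = "E - {(u, v), (v, u)}" and ?W = "V - {u}"
  have fin: "finite V" by (rule grown_tree_finite[OF assms(1)])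
  have u: "u \<in> V" using grown_tree_edgeD[OF assms(1)] assms(2) by blast
  have T: "grown_tree ?W ?F" by (rule grown_tree_remove_leaf[OF assms])
  have "recip_sum V E x \<le> recip_sum ?W ?F x + 1 / real (rdist E u x)" if "x \<in> ?W" for x
  proof -
    have "V - {x} = insert u (?W - {x})" using u that by auto
    then have "recip_sum V E x = 1 / real (rdist E x u) + (\<Sum>y\<in>?W - {x}. 1 / real (rdist E x y))"
      using fin unfolding recip_sum_def by simp
    also have "(\<Sum>y\<in>?W - {x}. 1 / real (rdist E x y)) \<le> recip_sum ?W ?F x"
      unfolding recip_sum_def
    proof (rule sum_mono)
      fix y assume y: "y \<in> ?W - {x}"
      have "rdist ?F x y \<le> rdist E x y"
        using that y u assms grown_tree_connected[OF assms(1)] grown_tree_sym[OF assms(1)]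
        by (intro rdist_remove_leaf) auto
      moreover have "1 \<le> rdist ?F x y"
        using that y by (intro rdist_pos grown_tree_connected[OF T]) auto
      ultimately show "1 / real (rdist E x y) \<le> 1 / real (rdist ?F x y)"
        by (intro frac_le) auto
    qed
    finally show ?thesis using rdist_sym[OF grown_tree_sym[OF assms(1)], of x u] by simp
  qed
  then have "(\<Sum>x\<in>?W. recip_sum V E x) \<le> (\<Sum>x\<in>?W. recip_sum ?W ?F x + 1 / real (rdist E u x))"
    by (rule sum_mono)
  also have "\<dots> = harary2 ?W ?F + recip_sum V E u"
    by (simp add: harary2_def recip_sum_def sum.distrib)
  finally show ?thesis using fin u by (simp add: harary2_def sum.remove[of V u])
qed

lemma sum_eq_card_imp:
  fixes f :: "'a \<Rightarrow> real"
  assumes "finite A" "\<And>x. x \<in> A \<Longrightarrow> f x \<le> c" "real (card A) * c \<le> sum f A" "x \<in> A"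
  shows "f x = c"
proof -
  have "(\<Sum>x\<in>A. c - f x) \<le> 0" using assms(3) by (simp add: sum_subtractf)
  moreover have "(\<Sum>x\<in>A. c - f x) \<ge> 0" using assms(2) by (intro sum_nonneg) auto
  ultimately have "(\<Sum>x\<in>A. c - f x) = 0" by simp
  then have "\<forall>x\<in>A. c - f x = 0" using assms(1,2) by (subst (asm) sum_nonneg_eq_0_iff) auto
  then show ?thesis using assms(4) by simp
qed

lemma card_nbrs_minus_leaf:
  assumes "grown_tree V E" "(v, u) \<in> E"
  shows "real (card (E `` {v} - {u})) = real (card (E `` {v})) - 1"
proof -
  have "finite (E `` {v})" using grown_tree_finite_edges[OF assms(1)] by (rule finite_Image)
  moreover have "u \<in> E `` {v}" using assms(2) by blast
  ultimately have "card (E `` {v}) = Suc (card (E `` {v} - {u}))" by (rule card.remove)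
  then show ?thesis by simp
qed

text \<open>Seen from the leaf, \<open>v\<close> is at distance at least 1, the other
  \<open>d - 1\<close> neighbours of \<open>v\<close> at least 2, the remaining
  \<open>n - 1 - d\<close> vertices at least 3. Equality forces exactly 3 on the last group, so
  these vertices are within 2 of \<open>v\<close>.\<close>

lemma recip_sum_leaf:
  assumes "grown_tree V E" "E `` {u} = {v}"
  defines "d \<equiv> real (card (E `` {v}))" and "n \<equiv> real (card V)"
  defines "B \<equiv> 1 + (d - 1) / 2 + (n - 1 - d) / 3"
  shows "recip_sum V E u \<le> B"
    and "recip_sum V E u = B \<Longrightarrow> x \<in> V \<Longrightarrow> (v, x) \<in> (E\<^sup>=) ^^ 2"
proof -
  let ?N = "E `` {v} - {u}" and ?R = "V - (E `` {v} \<union> {v})"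
  have fin: "finite V" by (rule grown_tree_finite[OF assms(1)])
  note con = grown_tree_connected[OF assms(1)] and ED = grown_tree_edgeD[OF assms(1)]
  have uv: "(u, v) \<in> E" "(v, u) \<in> E" "u \<in> V" "v \<in> V" "u \<noteq> v"
    using assms(2) ED grown_tree_symD[OF assms(1)] grown_tree_irrefl[OF assms(1)] by blast+
  have NV: "E `` {v} \<subseteq> V" using ED by blast
  have vN: "v \<notin> E `` {v}" using grown_tree_irrefl[OF assms(1)] by blast
  have finN: "finite (E `` {v})" using NV fin finite_subset by blast
  have split: "V - {u} = insert v (?N \<union> ?R)" "v \<notin> ?N \<union> ?R" "?N \<inter> ?R = {}"
    using uv NV vN by auto
  define f where "f y = 1 / real (rdist E u y)" for y
  have 1: "f v \<le> 1"
    using rdist_pos[OF con[OF uv(3,4)] uv(5)] by (simp add: f_def)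
  have 2: "f y \<le> 1 / 2" if "y \<in> ?N" for y
  proof -
    have "2 \<le> rdist E u y"
      using that NV uv assms(2) vN by (intro rdist_ge_2 con) auto
    then show ?thesis by (simp add: f_def field_simps)
  qed
  have 3: "f y \<le> 1 / 3" and 4: "f y = 1 / 3 \<Longrightarrow> (v, y) \<in> (E\<^sup>=) ^^ 2" if "y \<in> ?R" for y
  proof -
    have y: "y \<noteq> u" "(v, y) \<notin> (E\<^sup>=) ^^ 1" using that uv by auto
    have c: "(u, y) \<in> E\<^sup>*" using that uv con by blast
    have "3 \<le> rdist E u y" using rdist_leaf_gt[OF c assms(2) y] by simp
    then show "f y \<le> 1 / 3" by (simp add: f_def field_simps)
    show "(v, y) \<in> (E\<^sup>=) ^^ 2" if "f y = 1 / 3"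
    proof (rule ccontr)
      assume "(v, y) \<notin> (E\<^sup>=) ^^ 2"
      from rdist_leaf_gt[OF c assms(2) y(1) this] have "4 \<le> rdist E u y" by simp
      then show False using that by (simp add: f_def field_simps)
    qed
  qed
  have "recip_sum V E u = f v + (sum f ?N + sum f ?R)"
    unfolding recip_sum_def f_def[symmetric] split(1)
    using split fin finN by (simp add: sum.union_disjoint)
  moreover have "sum f ?N \<le> real (card ?N) * (1 / 2)" using 2 by (intro sum_bounded_above) auto
  moreover have cN: "real (card ?N) = d - 1"
    unfolding d_def by (rule card_nbrs_minus_leaf[OF assms(1) uv(2)])
  moreover have R: "sum f ?R \<le> real (card ?R) * (1 / 3)" using 3 by (intro sum_bounded_above) auto
  moreover have cR: "real (card ?R) = n - 1 - d"
  proof -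
    have "card (E `` {v} \<union> {v}) = card (E `` {v}) + 1" using finN vN by simp
    moreover have sub: "E `` {v} \<union> {v} \<subseteq> V" using NV uv by blast
    moreover have "card (E `` {v} \<union> {v}) \<le> card V" by (rule card_mono[OF fin sub])
    moreover have "card ?R = card V - card (E `` {v} \<union> {v})"
      by (rule card_Diff_subset[OF finite_subset[OF sub fin] sub])
    ultimately show ?thesis unfolding n_def d_def by linarith
  qed
  \<comment> \<open>Every group has its own bound, so equality of the totals forces equality on the
    far group \<open>?R\<close>.\<close>
  ultimately have le: "recip_sum V E u \<le> B \<and> (recip_sum V E u = B \<longrightarrow> real (card ?R) * (1 / 3) \<le> sum f ?R)"
    using 1 unfolding B_def by - (rule conjI, argo, rule impI, argo)
  then show "recip_sum V E u \<le> B" by blast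
  assume "recip_sum V E u = B" "x \<in> V"
  then have eq: "real (card ?R) * (1 / 3) \<le> sum f ?R" using le by blast
  show "(v, x) \<in> (E\<^sup>=) ^^ 2"
  proof (cases "x \<in> ?R")
    case True
    have "f x = 1 / 3" by (rule sum_eq_card_imp[OF _ 3 eq True]) (use fin in auto)
    then show ?thesis using 4[OF True] by blast
  next
    case False
    then show ?thesis using \<open>x \<in> V\<close> unfolding refl_relpow_2 by blast
  qed
qed

text \<open>One level deeper than \<open>recip_sum_leaf\<close>: \<open>v\<close> and
  \<open>w\<close> give at most 1 + 1/2, other neighbours of \<open>w\<close> at most 1/3 each, the
  remaining \<open>n - 2 - d\<close> vertices at most 1/4 each. Centring at \<open>w\<close> lets
  the deletions of \<open>u\<close> and of \<open>v\<close> be measured by the same degree.\<close>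

lemma recip_sum_pendant_path:
  assumes "grown_tree V E" "E `` {u} = {v}" "E `` {v} = {u, w}" "u \<noteq> w"
  defines "d \<equiv> real (card (E `` {w}))" and "n \<equiv> real (card V)"
  defines "B \<equiv> 3 / 2 + (d - 1) / 3 + (n - 2 - d) / 4"
  shows "recip_sum V E u \<le> B"
    and "recip_sum V E u = B \<Longrightarrow> x \<in> V \<Longrightarrow> (w, x) \<in> (E\<^sup>=) ^^ 2"
proof -
  let ?N = "E `` {w} - {v}" and ?R = "V - (E `` {w} \<union> {w, u})"
  have fin: "finite V" by (rule grown_tree_finite[OF assms(1)])
  note con = grown_tree_connected[OF assms(1)] and ED = grown_tree_edgeD[OF assms(1)]
  note symE = grown_tree_symD[OF assms(1)] and irr = grown_tree_irrefl[OF assms(1)]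
  have e: "(u, v) \<in> E" "(v, w) \<in> E" using assms(2,3) by blast+
  have "(u, w) \<notin> E" using assms(2) e(2) irr by (metis Image_singleton_iff singletonD)
  with e have uv: "(u, v) \<in> E" "(v, u) \<in> E" "u \<in> V" "v \<in> V" "u \<noteq> v" "(v, w) \<in> E" "(w, v) \<in> E"
    "w \<in> V" "v \<noteq> w" "(u, w) \<notin> E" "(w, u) \<notin> E"
    using ED symE irr by metis+
  have NV: "E `` {w} \<subseteq> V" using ED by blast
  have wN: "w \<notin> E `` {w}" "u \<notin> E `` {w}" using irr uv(11) by blast+
  have finN: "finite (E `` {w})" using NV fin finite_subset by blast
  have split: "V - {u} = insert v (insert w (?N \<union> ?R))" "v \<notin> insert w (?N \<union> ?R)"
    "w \<notin> ?N \<union> ?R" "?N \<inter> ?R = {}"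
    using uv NV wN \<open>u \<noteq> w\<close> by auto
  define f where "f y = 1 / real (rdist E u y)" for y
  have 1: "f v \<le> 1"
    using rdist_pos[OF con[OF uv(3,4)] uv(5)] by (simp add: f_def)
  have 2: "f w \<le> 1 / 2"
  proof -
    have "2 \<le> rdist E u w" using uv assms(4) by (intro rdist_ge_2 con) auto
    then show ?thesis by (simp add: f_def field_simps)
  qed
  have v: "t \<in> {u, v, w}" if "(v, t) \<in> (E\<^sup>=) ^^ 1" for t using that assms(3) by auto
  have v2: "(w, t) \<in> (E\<^sup>=) ^^ 1" if "(v, t) \<in> (E\<^sup>=) ^^ 2" "t \<noteq> u" for t
    using that assms(2,3) uv(7) unfolding refl_relpow_2 by auto
  \<comment> \<open>The first of the three steps ends in \<open>u\<close>, \<open>v\<close> or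
    \<open>w\<close>, and two further steps from any of these stay within 2 of \<open>w\<close>.
    Hence a vertex farther than 2 from \<open>w\<close> is at distance at least 5 from
    \<open>u\<close>.\<close>
  have v3: "(w, t) \<in> (E\<^sup>=) ^^ 2" if "(v, t) \<in> (E\<^sup>=) ^^ 3" for t
  proof -
    have "(v, t) \<in> (E\<^sup>=) ^^ Suc 2" using that by (simp only: eval_nat_numeral)
    then obtain s where s: "(v, s) \<in> E\<^sup>=" "(s, t) \<in> (E\<^sup>=) ^^ 2" by (rule relpow_Suc_E2)
    from s(1) have "(v, s) \<in> (E\<^sup>=) ^^ 1" by simp
    then have "s \<in> {u, v, w}" by (rule v)
    moreover have "(w, t) \<in> (E\<^sup>=) ^^ 2" if "s = u"
      using that s(2) uv assms(2,3) unfolding refl_relpow_2 by auto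
    moreover have "(w, t) \<in> (E\<^sup>=) ^^ 2" if "s = v"
      using that s(2) uv assms(2,3) unfolding refl_relpow_2 by auto
    ultimately show ?thesis using s(2) by blast
  qed
  have 3: "f y \<le> 1 / 3" if "y \<in> ?N" for y
  proof -
    have "y \<noteq> u" "(v, y) \<notin> (E\<^sup>=) ^^ 1" using that wN v[of y] by auto
    moreover have "(u, y) \<in> E\<^sup>*" using that uv NV con by blast
    ultimately have "3 \<le> rdist E u y" using rdist_leaf_gt[OF _ assms(2), of y 1] by simp
    then show ?thesis by (simp add: f_def field_simps)
  qed
  have 4: "f y \<le> 1 / 4" and 5: "f y = 1 / 4 \<Longrightarrow> (w, y) \<in> (E\<^sup>=) ^^ 2" if "y \<in> ?R" for y
  proof -
    have y: "y \<noteq> u" "(v, y) \<notin> (E\<^sup>=) ^^ 2" using that uv v2[of y] by auto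
    have c: "(u, y) \<in> E\<^sup>*" using that uv con by blast
    have "4 \<le> rdist E u y" using rdist_leaf_gt[OF c assms(2) y] by simp
    then show "f y \<le> 1 / 4" by (simp add: f_def field_simps)
    show "(w, y) \<in> (E\<^sup>=) ^^ 2" if "f y = 1 / 4"
    proof (rule ccontr)
      assume "(w, y) \<notin> (E\<^sup>=) ^^ 2"
      then have "(v, y) \<notin> (E\<^sup>=) ^^ 3" using v3 by blast
      from rdist_leaf_gt[OF c assms(2) y(1) this] have "5 \<le> rdist E u y" by simp
      then show False using that by (simp add: f_def field_simps)
    qed
  qed
  have finU: "finite (?N \<union> ?R)" "finite (insert w (?N \<union> ?R))" using fin finN by simp_all
  have "recip_sum V E u = f v + (f w + sum f (?N \<union> ?R))"
    unfolding recip_sum_def f_def[symmetric] split(1)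
      sum.insert[OF finU(2) split(2)] sum.insert[OF finU(1) split(3)] ..
  moreover have "sum f (?N \<union> ?R) = sum f ?N + sum f ?R"
    using fin finN split(4) by (intro sum.union_disjoint) auto
  moreover have "sum f ?N \<le> real (card ?N) * (1 / 3)" using 3 by (intro sum_bounded_above) auto
  moreover have cN: "real (card ?N) = d - 1"
    unfolding d_def by (rule card_nbrs_minus_leaf[OF assms(1) uv(7)])
  moreover have R: "sum f ?R \<le> real (card ?R) * (1 / 4)" using 4 by (intro sum_bounded_above) auto
  moreover have cR: "real (card ?R) = n - 2 - d"
  proof -
    have "card (E `` {w} \<union> {w, u}) = card (E `` {w}) + 2" using finN wN \<open>u \<noteq> w\<close> by simp
    moreover have sub: "E `` {w} \<union> {w, u} \<subseteq> V" using NV uv by blast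
    moreover have "card (E `` {w} \<union> {w, u}) \<le> card V" by (rule card_mono[OF fin sub])
    moreover have "card ?R = card V - card (E `` {w} \<union> {w, u})"
      by (rule card_Diff_subset[OF finite_subset[OF sub fin] sub])
    ultimately show ?thesis unfolding n_def d_def by linarith
  qed
  ultimately have le: "recip_sum V E u \<le> B \<and> (recip_sum V E u = B \<longrightarrow> real (card ?R) * (1 / 4) \<le> sum f ?R)"
    using 1 2 unfolding B_def by - (rule conjI, argo, rule impI, argo)
  then show "recip_sum V E u \<le> B" by blast
  assume "recip_sum V E u = B" "x \<in> V"
  then have eq: "real (card ?R) * (1 / 4) \<le> sum f ?R" using le by blast
  show "(w, x) \<in> (E\<^sup>=) ^^ 2"
  proof (cases "x \<in> ?R")
    case True
    have "f x = 1 / 4" by (rule sum_eq_card_imp[OF _ 4 eq True]) (use fin in auto)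
    then show ?thesis using 5[OF True] by blast
  next
    case False
    then show ?thesis using \<open>x \<in> V\<close> uv unfolding refl_relpow_2 by blast
  qed
qed

section \<open>Matchings\<close>

text \<open>Matchings of a bare arc relation, so that the induction can pass to smaller relations
  without graph records.\<close>

definition matchings :: "('a \<times> 'a) set \<Rightarrow> 'a set set set" where
  "matchings E = {M. M \<subseteq> {{u, v} | u v. (u, v) \<in> E} \<and> pairwise disjnt M}"

definition max_matching :: "('a \<times> 'a) set \<Rightarrow> nat" where
  "max_matching E = Max (card ` matchings E)"

lemma matching_number_eq: "matching_number G = max_matching (parcs G)"
  by (simp add: matching_number_def max_matching_def matchings_def is_matching_def uedges_def)

lemma finite_edge_sets: "finite E \<Longrightarrow> finite {{u, v} | u v. (u, v) \<in> E}"
proof -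
  assume "finite E"
  moreover have "{{u, v} | u v. (u, v) \<in> E} = (\<lambda>(u, v). {u, v}) ` E" by auto
  ultimately show ?thesis by simp
qed

lemma finite_matchings: "finite E \<Longrightarrow> finite (matchings E)"
  unfolding matchings_def
  by (rule finite_subset[of _ "Pow {{u, v} | u v. (u, v) \<in> E}"]) (auto simp: finite_edge_sets)

lemma finite_matching: "finite E \<Longrightarrow> M \<in> matchings E \<Longrightarrow> finite M"
  unfolding matchings_def using finite_edge_sets finite_subset by blast

lemma card_matching_le: "finite E \<Longrightarrow> M \<in> matchings E \<Longrightarrow> card M \<le> max_matching E"
  unfolding max_matching_def by (rule Max_ge) (simp_all add: finite_matchings)

lemma max_matching_witness:
  assumes "finite E"
  obtains M where "M \<in> matchings E" "card M = max_matching E"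
proof -
  have "{} \<in> matchings E" by (simp add: matchings_def)
  then have "max_matching E \<in> card ` matchings E"
    unfolding max_matching_def using finite_matchings[OF assms] by (intro Max_in) auto
  then show ?thesis using that by auto
qed

lemma matching_edgeE:
  assumes "M \<in> matchings E" "e \<in> M"
  obtains x y where "e = {x, y}" "(x, y) \<in> E"
  using assms by (auto simp: matchings_def)

lemma matching_disjoint:
  "M \<in> matchings E \<Longrightarrow> e \<in> M \<Longrightarrow> e' \<in> M \<Longrightarrow> x \<in> e \<Longrightarrow> x \<in> e' \<Longrightarrow> e = e'"
  by (auto simp: matchings_def pairwise_def disjnt_def)

lemma matchingsI:
  assumes "\<And>e. e \<in> M \<Longrightarrow> \<exists>x y. e = {x, y} \<and> (x, y) \<in> E"
    and "\<And>e e' x. e \<in> M \<Longrightarrow> e' \<in> M \<Longrightarrow> x \<in> e \<Longrightarrow> x \<in> e' \<Longrightarrow> e = e'"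
  shows "M \<in> matchings E"
  unfolding matchings_def pairwise_def disjnt_def using assms by blast

lemma matchings_subset:
  assumes "M \<in> matchings E" "M' \<subseteq> M"
    and "\<And>x y. (x, y) \<in> E \<Longrightarrow> {x, y} \<in> M' \<Longrightarrow> (x, y) \<in> E'"
  shows "M' \<in> matchings E'"
proof (rule matchingsI)
  fix e assume e: "e \<in> M'"
  then have "e \<in> M" using assms(2) by blast
  with assms(1) obtain x y where "e = {x, y}" "(x, y) \<in> E" by (rule matching_edgeE)
  moreover from this have "(x, y) \<in> E'" using assms(3) e by simp
  ultimately show "\<exists>x y. e = {x, y} \<and> (x, y) \<in> E'" by blast
next
  fix e e' x assume "e \<in> M'" "e' \<in> M'" "x \<in> e" "x \<in> e'"
  then show "e = e'" using matching_disjoint[OF assms(1), of e e' x] assms(2) by blast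
qed

text \<open>Each matching edge is sent to one of its ends in \<open>C\<close>; disjoint edges
  receive different ends.\<close>

lemma max_matching_le_cover:
  assumes "finite E" "finite C" "\<And>x y. (x, y) \<in> E \<Longrightarrow> x \<in> C \<or> y \<in> C"
  shows "max_matching E \<le> card C"
proof -
  obtain M where M: "M \<in> matchings E" "card M = max_matching E"
    using max_matching_witness[OF assms(1)] .
  have "\<exists>x. x \<in> e \<and> x \<in> C" if e: "e \<in> M" for e
  proof -
    obtain x y where "e = {x, y}" "(x, y) \<in> E" using M(1) e by (rule matching_edgeE)
    then show ?thesis using assms(3)[of x y] by blast
  qed
  then obtain f where f: "\<And>e. e \<in> M \<Longrightarrow> f e \<in> e \<and> f e \<in> C" by metis
  have "inj_on f M"
  proof (rule inj_onI)
    fix e e' assume e: "e \<in> M" "e' \<in> M" "f e = f e'"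
    show "e = e'" by (rule matching_disjoint[OF M(1) e(1,2), of "f e"]) (use f[OF e(1)] f[OF e(2)] e(3) in simp_all)
  qed
  then have "card M \<le> card C" using f assms(2) by (intro card_inj_on_le[of f]) auto
  then show ?thesis using M by simp
qed

text \<open>By \<open>grown_tree_triangle_free\<close> the complement of the neighbourhood of
  \<open>v\<close> is a vertex cover.\<close>

lemma degree_matching_le:
  assumes "grown_tree V E"
  shows "card (E `` {v}) + max_matching E \<le> card V"
proof -
  have fin: "finite V" by (rule grown_tree_finite[OF assms])
  have sub: "E `` {v} \<subseteq> V" using grown_tree_edgeD[OF assms] by blast
  have "max_matching E \<le> card (V - E `` {v})"
  proof (rule max_matching_le_cover)
    fix x y assume "(x, y) \<in> E"
    then show "x \<in> V - E `` {v} \<or> y \<in> V - E `` {v}"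
      using grown_tree_edgeD[OF assms, of x y] grown_tree_triangle_free[OF assms, of v x y] by blast
  qed (use fin grown_tree_finite_edges[OF assms] in auto)
  also have "card (V - E `` {v}) = card V - card (E `` {v})"
    using sub fin finite_subset by (intro card_Diff_subset) auto
  finally show ?thesis using card_mono[OF fin sub] by simp
qed

text \<open>Matching edges occupy disjoint pairs of vertices. For m = n - \<beta> this gives m \<ge>
  n / 2, so the spur parameters are admissible.\<close>

lemma matching_twice_le:
  assumes "grown_tree V E"
  shows "2 * max_matching E \<le> card V"
proof -
  have finE: "finite E" by (rule grown_tree_finite_edges[OF assms])
  obtain M where M: "M \<in> matchings E" "card M = max_matching E"
    using max_matching_witness[OF finE] .
  have e: "card e = 2 \<and> finite e \<and> e \<subseteq> V" if e: "e \<in> M" for e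
  proof -
    obtain x y where xy: "e = {x, y}" "(x, y) \<in> E" using M(1) e by (rule matching_edgeE)
    then have "x \<noteq> y" using grown_tree_irrefl[OF assms] by metis
    then show ?thesis using xy grown_tree_edgeD[OF assms xy(2)] by simp
  qed
  have "card (\<Union>M) = sum card M"
    using M(1) e by (intro card_Union_disjoint) (auto simp: matchings_def)
  also have "\<dots> = 2 * card M" using e by simp
  finally show ?thesis
    using card_mono[OF grown_tree_finite[OF assms], of "\<Union>M"] e M(2) by auto
qed

text \<open>Exchange argument: a matching that uses \<open>{u, v}\<close> can use
  \<open>{u', v}\<close> instead, since its other edges avoid \<open>v\<close> and \<open>u'\<close>
  has no other neighbour.\<close>

lemma max_matching_remove_twin_leaf:
  assumes "finite E" "sym E" "E `` {u} = {v}" "E `` {u'} = {v}" "u \<noteq> u'"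
  shows "max_matching (E - {(u, v), (v, u)}) = max_matching E"
proof (rule antisym)
  let ?F = "E - {(u, v), (v, u)}"
  have finF: "finite ?F" using assms(1) by simp
  obtain M where M: "M \<in> matchings ?F" "card M = max_matching ?F"
    using max_matching_witness[OF finF] .
  have "M \<in> matchings E" by (rule matchings_subset[OF M(1)]) auto
  then show "max_matching ?F \<le> max_matching E" using card_matching_le[OF assms(1)] M(2) by metis
next
  let ?F = "E - {(u, v), (v, u)}"
  have finF: "finite ?F" using assms(1) by simp
  obtain M where M: "M \<in> matchings E" "card M = max_matching E"
    using max_matching_witness[OF assms(1)] .
  have nbr: "y = v" if "(u', y) \<in> E \<or> (y, u') \<in> E" for y
    using that assms(4) symD[OF assms(2)] by blast
  show "max_matching E \<le> max_matching ?F"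
  proof (cases "{u, v} \<in> M")
    case False
    have "M \<in> matchings ?F"
    proof (rule matchings_subset[OF M(1)])
      fix x y assume "(x, y) \<in> E" "{x, y} \<in> M"
      then show "(x, y) \<in> ?F" using False by (auto simp: insert_commute)
    qed simp
    then show ?thesis using card_matching_le[OF finF] M(2) by metis
  next
    case True
    let ?N = "M - {{u, v}}"
    have uv': "(u', v) \<in> ?F" using assms(4,5) symD[OF assms(2)] by auto
    have vN: "v \<notin> e" if "e \<in> ?N" for e using matching_disjoint[OF M(1) True, of e v] that by blast
    have uN: "u' \<notin> e" if e: "e \<in> ?N" for e
    proof
      assume "u' \<in> e"
      obtain x y where xy: "e = {x, y}" "(x, y) \<in> E" using M(1) e by (blast elim: matching_edgeE)
      then have "v \<in> e" using \<open>u' \<in> e\<close> nbr by blast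
      then show False using vN[OF e] by blast
    qed
    have "insert {u', v} ?N \<in> matchings ?F"
    proof (rule matchingsI)
      fix e assume "e \<in> insert {u', v} ?N"
      then show "\<exists>x y. e = {x, y} \<and> (x, y) \<in> ?F"
      proof
        assume "e \<in> ?N"
        then obtain x y where "e = {x, y}" "(x, y) \<in> E" using M(1) by (blast elim: matching_edgeE)
        moreover have "v \<notin> e" by (rule vN[OF \<open>e \<in> ?N\<close>])
        ultimately show ?thesis by blast
      qed (use uv' in blast)
    next
      fix e e' x assume "e \<in> insert {u', v} ?N" "e' \<in> insert {u', v} ?N" "x \<in> e" "x \<in> e'"
      then show "e = e'" using vN uN matching_disjoint[OF M(1), of e e' x] by blast
    qed
    then have "card (insert {u', v} ?N) \<le> max_matching ?F" by (rule card_matching_le[OF finF])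
    moreover have "card (insert {u', v} ?N) = card M"
    proof -
      have "{u', v} \<notin> ?N" using vN by blast
      moreover have finM: "finite M" by (rule finite_matching[OF assms(1) M(1)])
      ultimately have "card (insert {u', v} ?N) = Suc (card ?N)" by (intro card_insert_disjoint) simp_all
      also have "\<dots> = card M" by (rule card.remove[OF finM True, symmetric])
      finally show ?thesis .
    qed
    ultimately show ?thesis using M(2) by simp
  qed
qed

text \<open>A matching has at most one edge at \<open>v\<close>. Conversely, once the arcs at
  \<open>v\<close> are gone \<open>u\<close> is isolated, so \<open>{u, v}\<close> extends every
  matching of the rest.\<close>

lemma max_matching_remove_pendant_edge:
  assumes "finite E" "sym E" "E `` {u} = {v}" "u \<noteq> v"
  shows "max_matching E = Suc (max_matching {(x, y) \<in> E. x \<noteq> v \<and> y \<noteq> v})"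
proof (rule antisym)
  let ?F = "{(x, y) \<in> E. x \<noteq> v \<and> y \<noteq> v}"
  have finF: "finite ?F" using assms(1) by (rule rev_finite_subset) auto
  obtain M where M: "M \<in> matchings E" "card M = max_matching E"
    using max_matching_witness[OF assms(1)] .
  have finM: "finite M" by (rule finite_matching[OF assms(1) M(1)])
  let ?N = "{e \<in> M. v \<notin> e}" and ?K = "{e \<in> M. v \<in> e}"
  have "?N \<in> matchings ?F" by (rule matchings_subset[OF M(1)]) auto
  then have "card ?N \<le> max_matching ?F" by (rule card_matching_le[OF finF])
  moreover have "card ?K \<le> 1"
    using matching_disjoint[OF M(1), of _ _ v] finM by (auto simp: card_le_Suc0_iff_eq)
  moreover have "card M = card (?N \<union> ?K)" by (rule arg_cong[where f = card]) blast
  moreover have "card (?N \<union> ?K) \<le> card ?N + card ?K" by (rule card_Un_le)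
  ultimately show "max_matching E \<le> Suc (max_matching ?F)" using M(2) by linarith
next
  let ?F = "{(x, y) \<in> E. x \<noteq> v \<and> y \<noteq> v}"
  have finF: "finite ?F" using assms(1) by (rule rev_finite_subset) auto
  obtain M where M: "M \<in> matchings ?F" "card M = max_matching ?F"
    using max_matching_witness[OF finF] .
  have uv: "u \<notin> e \<and> v \<notin> e" if e: "e \<in> M" for e
  proof -
    obtain x y where "e = {x, y}" "(x, y) \<in> ?F" using M(1) e by (rule matching_edgeE)
    moreover have "x \<noteq> u" "y \<noteq> u" if "(x, y) \<in> ?F" for x y
      using that assms(3) symD[OF assms(2)] by blast+
    ultimately show ?thesis by blast
  qed
  have "insert {u, v} M \<in> matchings E"
  proof (rule matchingsI)
    fix e assume "e \<in> insert {u, v} M"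
    then show "\<exists>x y. e = {x, y} \<and> (x, y) \<in> E"
    proof
      assume "e \<in> M"
      with M(1) obtain x y where "e = {x, y}" "(x, y) \<in> ?F" by (rule matching_edgeE)
      then show ?thesis by blast
    qed (use assms(3) in blast)
  next
    fix e e' x assume "e \<in> insert {u, v} M" "e' \<in> insert {u, v} M" "x \<in> e" "x \<in> e'"
    then show "e = e'" using uv matching_disjoint[OF M(1), of e e' x] by blast
  qed
  then have "card (insert {u, v} M) \<le> max_matching E" by (rule card_matching_le[OF assms(1)])
  moreover have "{u, v} \<notin> M" using uv by blast
  ultimately show "Suc (max_matching ?F) \<le> max_matching E"
    using finite_matching[OF finF M(1)] M(2) by simp
qed

section \<open>The upper bound\<close>

text \<open>Twice the bound of the theorem, to match \<open>harary2\<close>; real arguments keep the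
  decrements free of truncated subtraction.\<close>

definition harary_bound :: "real \<Rightarrow> real \<Rightarrow> real" where
  "harary_bound n b = (6 * n\<^sup>2 - 4 * b * n + b\<^sup>2 + 9 * b + 10 * n - 22) / 12"

text \<open>Equality is recorded by a centre, and the identification with the spur is left to
  \<open>spur_of_centre\<close>. The induction is a strong one because a pendant path removes two
  vertices.\<close>

lemma harary2_upper:
  assumes "grown_tree V E" "2 \<le> card V"
  shows "harary2 V E \<le> harary_bound (card V) (max_matching E) \<and>
    (harary2 V E = harary_bound (card V) (max_matching E) \<longrightarrow>
      (\<exists>c\<in>V. card (E `` {c}) + max_matching E = card V \<and> (\<forall>x\<in>V. (c, x) \<in> (E\<^sup>=) ^^ 2)))"
  using assms
proof (induction "card V" arbitrary: V E rule: less_induct)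
  case less
  note T = less.prems(1)
  note finE = grown_tree_finite_edges[OF T] and finV = grown_tree_finite[OF T]
  note symE = grown_tree_sym[OF T] and irr = grown_tree_irrefl[OF T] and ED = grown_tree_edgeD[OF T]
  consider "card V = 2" | "3 \<le> card V" using less.prems(2) by linarith
  then show ?case
  proof cases
    case 1
    from T 1 obtain a b where ab: "a \<noteq> b" "V = {a, b}" "E = {(a, b), (b, a)}"
      by (rule grown_tree_card_2)
    have Ea: "E `` {a} = {b}" and Eb: "E `` {b} = {a}" using ab by auto
    have "{(x, y) \<in> E. x \<noteq> b \<and> y \<noteq> b} = {}" using ab by auto
    moreover have "max_matching ({} :: ('a \<times> 'a) set) = 0"
      by (simp add: max_matching_def matchings_def)
    ultimately have m: "max_matching E = 1"
      using max_matching_remove_pendant_edge[OF finE symE Ea ab(1)] by (simp only: One_nat_def)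
    have "recip_sum V E a \<le> 1" "recip_sum V E b \<le> 1"
      using recip_sum_leaf(1)[OF T Ea] recip_sum_leaf(1)[OF T Eb] 1 Ea Eb by simp_all
    then have "harary2 V E \<le> 2" using ab by (simp add: harary2_def)
    moreover have "harary_bound (card V) (max_matching E) = 2" using 1 m by (simp add: harary_bound_def)
    moreover have "(a, x) \<in> (E\<^sup>=) ^^ 2" if "x \<in> V" for x
      using that ab unfolding refl_relpow_2 by auto
    moreover have "card (E `` {a}) + max_matching E = card V" "a \<in> V" using m 1 Ea ab by simp_all
    ultimately show ?thesis by metis
  next
    case 2
    from T 2 show ?thesis
    proof (cases rule: grown_tree_pendant_cases)
      case (cherry u u' v)
      let ?F = "E - {(u, v), (v, u)}" and ?W = "V - {u}"
      define n b d where "n = real (card V)" and "b = real (max_matching E)"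
        and "d = real (card (E `` {v}))"
      have uV: "u \<in> V" "v \<in> V" using cherry ED by blast+
      have cW: "card ?W = card V - 1" using uV finV by simp
      have T': "grown_tree ?W ?F" by (rule grown_tree_remove_leaf[OF T cherry(2)])
      have m: "max_matching ?F = max_matching E"
        by (rule max_matching_remove_twin_leaf[OF finE symE cherry(2,3,1)])
      have "harary2 ?W ?F \<le> harary_bound (card ?W) (max_matching ?F)"
        using less.hyps[OF _ T'] cW 2 by fastforce
      moreover have "real (card ?W) = n - 1" using cW 2 by (simp add: n_def)
      ultimately have H1: "harary2 ?W ?F \<le> harary_bound (n - 1) b" by (simp add: m b_def)
      have H2: "harary2 V E \<le> harary2 ?W ?F + 2 * recip_sum V E u"
        by (rule harary2_remove_leaf[OF T cherry(2)])
      have H3: "recip_sum V E u \<le> 1 + (d - 1) / 2 + (n - 1 - d) / 3"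
        unfolding d_def n_def by (rule recip_sum_leaf(1)[OF T cherry(2)])
      have H4: "d + b \<le> n" using degree_matching_le[OF T, of v] unfolding n_def d_def b_def by linarith
      \<comment> \<open>The bracket is the bound of \<open>H3\<close> at
        \<open>d = n - b\<close>.\<close>
      have F: "harary_bound n b = harary_bound (n - 1) b + 2 * (n / 2 + 1 / 6 - b / 6)"
        by (simp add: harary_bound_def field_simps power2_eq_square)
      have le: "harary2 V E \<le> harary_bound n b" using H1 H2 H3 H4 F by argo
      moreover have "\<exists>c\<in>V. card (E `` {c}) + max_matching E = card V \<and> (\<forall>x\<in>V. (c, x) \<in> (E\<^sup>=) ^^ 2)"
        if eq: "harary2 V E = harary_bound n b"
      proof -
        \<comment> \<open>When the ends of the chain \<open>H1\<close> to \<open>H4\<close> agree no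
          link has slack, which fixes both the reciprocal sum and \<open>d\<close>.\<close>
        have "recip_sum V E u = 1 + (d - 1) / 2 + (n - 1 - d) / 3"
          using eq H1 H2 H3 H4 F by argo
        then have "(v, x) \<in> (E\<^sup>=) ^^ 2" if "x \<in> V" for x
          using that unfolding n_def d_def by (intro recip_sum_leaf(2)[OF T cherry(2)])
        moreover have "d + b = n" using eq H1 H2 H3 H4 F by argo
        then have "card (E `` {v}) + max_matching E = card V" unfolding n_def d_def b_def by linarith
        ultimately show ?thesis using uV by blast
      qed
      ultimately show ?thesis unfolding n_def b_def by blast
    next
      case (path u v w)
      let ?F = "E - {(u, v), (v, u)}" and ?W = "V - {u}"
      let ?G = "?F - {(v, w), (w, v)}" and ?X = "?W - {v}"
      define n b d where "n = real (card V)" and "b = real (max_matching E)"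
        and "d = real (card (E `` {w}))"
      have e: "(u, v) \<in> E" "(v, w) \<in> E" using path by blast+
      then have uV: "u \<in> V" "v \<in> V" "w \<in> V" "u \<noteq> v" "v \<noteq> w" using ED irr by metis+
      have cW: "card ?W = card V - 1" using uV finV by simp
      have cX: "card ?X = card V - 2" using uV finV by simp
      have T': "grown_tree ?W ?F" by (rule grown_tree_remove_leaf[OF T path(3)])
      have Fv: "?F `` {v} = {w}" using path(2,4) uV by auto
      have T'': "grown_tree ?X ?G" by (rule grown_tree_remove_leaf[OF T' Fv])
      \<comment> \<open>Deleting \<open>u\<close> and then \<open>v\<close> removes exactly the arcs
        at \<open>v\<close>, as \<open>u\<close> and \<open>w\<close> are its only
        neighbours.\<close>
      have "{(x, y) \<in> E. x \<noteq> v \<and> y \<noteq> v} = ?G"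
      proof -
        have "(x, v) \<in> E \<Longrightarrow> x = u \<or> x = w" "(v, x) \<in> E \<Longrightarrow> x = u \<or> x = w" for x
          using path(4) symD[OF symE] by blast+
        then show ?thesis by blast
      qed
      then have m: "max_matching E = Suc (max_matching ?G)"
        using max_matching_remove_pendant_edge[OF finE symE path(3) uV(4)] by simp
      have "harary2 ?X ?G \<le> harary_bound (card ?X) (max_matching ?G)"
        using less.hyps[OF _ T''] cX path(1) by fastforce
      moreover have "real (card ?X) = n - 2" using cX path(1) by (simp add: n_def)
      moreover have "real (max_matching ?G) = b - 1" using m by (simp add: b_def)
      ultimately have H1: "harary2 ?X ?G \<le> harary_bound (n - 2) (b - 1)" by simp
      have H2: "harary2 V E \<le> harary2 ?W ?F + 2 * recip_sum V E u"
        by (rule harary2_remove_leaf[OF T path(3)])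
      have H3: "harary2 ?W ?F \<le> harary2 ?X ?G + 2 * recip_sum ?W ?F v"
        by (rule harary2_remove_leaf[OF T' Fv])
      \<comment> \<open>Deleting \<open>u\<close> does not change the degree of \<open>w\<close>, so
        \<open>d\<close> serves for both deletions.\<close>
      have "?F `` {w} = E `` {w}" using path(2) uV by auto
      moreover have "real (card ?W) = n - 1" using cW path(1) by (simp add: n_def)
      ultimately have H4: "recip_sum ?W ?F v \<le> 1 + (d - 1) / 2 + (n - 1 - 1 - d) / 3"
        using recip_sum_leaf(1)[OF T' Fv] by (simp add: d_def)
      have H5: "recip_sum V E u \<le> 3 / 2 + (d - 1) / 3 + (n - 2 - d) / 4"
        unfolding d_def n_def by (rule recip_sum_pendant_path(1)[OF T path(3,4,2)])
      have H6: "d + b \<le> n" using degree_matching_le[OF T, of w] unfolding n_def d_def b_def by linarith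
      \<comment> \<open>The bracket is the sum of the bounds of \<open>H4\<close> and
        \<open>H5\<close> at \<open>d = n - b\<close>.\<close>
      have F: "harary_bound n b = harary_bound (n - 2) (b - 1) + 2 * (5 * n / 6 - b / 4 + 1 / 2)"
        by (simp add: harary_bound_def field_simps power2_eq_square)
      have le: "harary2 V E \<le> harary_bound n b" using H1 H2 H3 H4 H5 H6 F by argo
      moreover have "\<exists>c\<in>V. card (E `` {c}) + max_matching E = card V \<and> (\<forall>x\<in>V. (c, x) \<in> (E\<^sup>=) ^^ 2)"
        if eq: "harary2 V E = harary_bound n b"
      proof -
        have "recip_sum V E u = 3 / 2 + (d - 1) / 3 + (n - 2 - d) / 4"
          using eq H1 H2 H3 H4 H5 H6 F by argo
        then have "(w, x) \<in> (E\<^sup>=) ^^ 2" if "x \<in> V" for x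
          using that unfolding n_def d_def by (intro recip_sum_pendant_path(2)[OF T path(3,4,2)])
        moreover have "d + b = n" using eq H1 H2 H3 H4 H5 H6 F by argo
        then have "card (E `` {w}) + max_matching E = card V" unfolding n_def d_def b_def by linarith
        ultimately show ?thesis using uV by blast
      qed
      ultimately show ?thesis unfolding n_def b_def by blast
    qed
  qed
qed

section \<open>Transfer from simple trees\<close>

lemma apath_with_proj_iff:
  "pre_digraph.apath (with_proj G) u p v \<longleftrightarrow>
     u \<in> pverts G \<and> set p \<subseteq> parcs G \<and> pcas u p v \<and> distinct (pawalk_verts u p)"
  by (simp add: pre_digraph.apath_def pre_digraph.awalk_def cas_with_proj_eq awalk_verts_with_proj_eq)

lemma pcas_snoc: "pcas u (p @ [e]) v \<longleftrightarrow> pcas u p (fst e) \<and> v = snd e"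
  by (induction p arbitrary: u) auto

lemma pawalk_verts_snoc: "pcas u p (fst e) \<Longrightarrow> pawalk_verts u (p @ [e]) = pawalk_verts u p @ [snd e]"
  by (induction p arbitrary: u) auto

text \<open>Cutting out cycles can only shorten a walk. \<open>path_dist\<close> minimises over
  paths and \<open>rdist\<close> over walks; this makes the two minima agree.\<close>

lemma (in wf_digraph) length_awalk_to_apath_le:
  assumes "awalk u p v"
  shows "length (awalk_to_apath p) \<le> length p"
  using assms
proof (induct rule: awalk_to_apath_induct)
  case (path p)
  then show ?case by (auto simp: awalk_to_apath.simps)
next
  case (decomp p q r s)
  from decomp(2,1,3) have "p = q @ r @ s" by (rule awalk_cyc_decompE)
  then show ?case using decomp(4) step_awalk_to_apath[OF decomp(1-3)] by simp
qed

text \<open>Stationary steps are dropped, hence only an upper bound on the length.\<close>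

lemma walk_of_refl_relpow:
  "(x, y) \<in> (E\<^sup>=) ^^ k \<Longrightarrow> \<exists>p. set p \<subseteq> E \<and> pcas x p y \<and> length p \<le> k"
proof (induction k arbitrary: x)
  case 0
  then show ?case by (intro exI[of _ "[]"]) simp
next
  case (Suc k)
  obtain s where s: "(x, s) \<in> E\<^sup>=" "(s, y) \<in> (E\<^sup>=) ^^ k" using Suc.prems by (rule relpow_Suc_E2)
  obtain p where p: "set p \<subseteq> E" "pcas s p y" "length p \<le> k" using Suc.IH[OF s(2)] by blast
  show ?case
  proof (cases "x = s")
    case True
    then show ?thesis using p by (intro exI[of _ p]) simp
  next
    case False
    then show ?thesis using p s by (intro exI[of _ "(x, s) # p"]) simp
  qed
qed

lemma refl_relpow_of_walk:
  "set p \<subseteq> E \<Longrightarrow> pcas x p y \<Longrightarrow> (x, y) \<in> (E\<^sup>=) ^^ length p"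
proof (induction p arbitrary: x)
  case (Cons e p)
  then have "(x, snd e) \<in> E\<^sup>=" "(snd e, y) \<in> (E\<^sup>=) ^^ length p" by auto
  then show ?case unfolding list.size(4) add_Suc_right add_0_right by (rule relpow_Suc_I2)
qed simp

lemma path_dist_eq_rdist:
  assumes "pair_wf_digraph G" "x \<in> pverts G" "(x, y) \<in> (parcs G)\<^sup>*"
  shows "path_dist G x y = rdist (parcs G) x y"
proof -
  interpret pair_wf_digraph G by (rule assms(1))
  have ap: "\<exists>q. apath x q y \<and> length q \<le> k" if xy: "(x, y) \<in> ((parcs G)\<^sup>=) ^^ k" for k
  proof -
    obtain p where "set p \<subseteq> parcs G" "pcas x p y" "length p \<le> k"
      using walk_of_refl_relpow[OF xy] by blast
    moreover from this have "awalk x p y" using assms(2) by (simp add: awalk_def)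
    ultimately show ?thesis
      using apath_awalk_to_apath length_awalk_to_apath_le le_trans by blast
  qed
  have rp: "(x, y) \<in> ((parcs G)\<^sup>=) ^^ length q" if "apath x q y" for q
    using that unfolding apath_with_proj_iff by (blast intro: refl_relpow_of_walk)
  obtain q where q: "apath x q y" "length q \<le> rdist (parcs G) x y"
    using ap[OF refl_relpow_rdist[OF assms(3)]] by blast
  show ?thesis unfolding path_dist_def
  proof (rule Least_equality)
    have "length q = rdist (parcs G) x y" using q(2) rdist_leI[OF rp[OF q(1)]] by simp
    then show "\<exists>p. apath x p y \<and> length p = rdist (parcs G) x y" using q(1) by blast
  next
    fix k assume "\<exists>p. apath x p y \<and> length p = k"
    then obtain p where p: "apath x p y" "length p = k" by blast
    show "rdist (parcs G) x y \<le> k" using rdist_leI[OF rp[OF p(1)]] p(2) by simp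
  qed
qed

text \<open>The path has to stay inside \<open>S\<close>, so that joining both its ends to a vertex
  outside \<open>S\<close> repeats no vertex and gives a cycle.\<close>

lemma grown_tree_apath:
  "grown_tree S F \<Longrightarrow> F \<subseteq> parcs G \<Longrightarrow> S \<subseteq> pverts G \<Longrightarrow> s \<in> S \<Longrightarrow> s' \<in> S \<Longrightarrow>
     \<exists>p. pre_digraph.apath (with_proj G) s p s' \<and> set (pawalk_verts s p) \<subseteq> S"
proof (induction arbitrary: s s' rule: grown_tree.induct)
  case (single a)
  then show ?case by (intro exI[of _ "[]"]) (simp add: apath_with_proj_iff)
next
  case (add_leaf V E y x)
  have sub: "E \<subseteq> parcs G" "V \<subseteq> pverts G" "(x, y) \<in> parcs G" "(y, x) \<in> parcs G" "x \<in> pverts G"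
    using add_leaf.prems by auto
  note IH = add_leaf.IH[OF sub(1,2), unfolded apath_with_proj_iff]
  show ?case unfolding apath_with_proj_iff
  proof (cases "s = x"; cases "s' = x")
    assume "s \<noteq> x" "s' \<noteq> x"
    then have "s \<in> V" "s' \<in> V" using add_leaf.prems by blast+
    from IH[OF this] show "\<exists>p. (s \<in> pverts G \<and> set p \<subseteq> parcs G \<and> pcas s p s' \<and> distinct (pawalk_verts s p))
        \<and> set (pawalk_verts s p) \<subseteq> insert x V" by blast
  next
    assume "s = x" "s' = x"
    then show "\<exists>p. (s \<in> pverts G \<and> set p \<subseteq> parcs G \<and> pcas s p s' \<and> distinct (pawalk_verts s p))
        \<and> set (pawalk_verts s p) \<subseteq> insert x V"
      using sub by (intro exI[of _ "[]"]) simp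
  next
    assume s: "s = x" "s' \<noteq> x"
    then have "s' \<in> V" using add_leaf.prems by blast
    from IH[OF add_leaf.hyps(2) this] obtain p where
      p: "set p \<subseteq> parcs G" "pcas y p s'" "distinct (pawalk_verts y p)" "set (pawalk_verts y p) \<subseteq> V"
      by blast
    show "\<exists>p. (s \<in> pverts G \<and> set p \<subseteq> parcs G \<and> pcas s p s' \<and> distinct (pawalk_verts s p))
        \<and> set (pawalk_verts s p) \<subseteq> insert x V"
      using p s sub add_leaf.hyps(3) by (intro exI[of _ "(x, y) # p"]) auto
  next
    assume s: "s \<noteq> x" "s' = x"
    then have "s \<in> V" using add_leaf.prems by blast
    from IH[OF this add_leaf.hyps(2)] obtain p where
      p: "s \<in> pverts G" "set p \<subseteq> parcs G" "pcas s p y" "distinct (pawalk_verts s p)"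
        "set (pawalk_verts s p) \<subseteq> V"
      by blast
    have "pawalk_verts s (p @ [(y, x)]) = pawalk_verts s p @ [x]"
      using pawalk_verts_snoc[of s p "(y, x)"] p(3) by simp
    then show "\<exists>p. (s \<in> pverts G \<and> set p \<subseteq> parcs G \<and> pcas s p s' \<and> distinct (pawalk_verts s p))
        \<and> set (pawalk_verts s p) \<subseteq> insert x V"
      using p s sub add_leaf.hyps(3) by (intro exI[of _ "p @ [(y, x)]"]) (auto simp: pcas_snoc)
  qed
qed

text \<open>Connectedness is defined through the symmetric closure, which adds nothing to arcs that
  are already symmetric.\<close>

lemma simple_tree_connected:
  assumes "simple_tree T" "x \<in> pverts T" "y \<in> pverts T"
  shows "(x, y) \<in> (parcs T)\<^sup>*"
proof -
  interpret pair_graph T using assms(1) by (simp add: simple_tree_def)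
  have "Digraph_Component.connected (with_proj T)" using assms(1) by (simp add: simple_tree_def)
  then have "x \<rightarrow>\<^sup>*\<^bsub>with_proj (mk_symmetric (with_proj T))\<^esub> y"
    using assms(2,3) by (simp add: Digraph_Component.connected_def strongly_connected_def)
  then have "(x, y) \<in> (parcs (mk_symmetric (with_proj T)))\<^sup>*"
    using reachable_rtranclI by fastforce
  moreover have "parcs (mk_symmetric (with_proj T)) = parcs T"
    using adj_mk_symmetric_eq[OF pair_sym_arcs] by simp
  ultimately show ?thesis by simp
qed

text \<open>A subtree that is maximal among the grown ones is spanning: a vertex adjacent to it has
  only one neighbour in it, since two neighbours would close a cycle.\<close>

lemma simple_tree_grown:
  assumes "simple_tree T"
  shows "grown_tree (pverts T) (parcs T)"
proof -
  interpret pair_graph T using assms by (simp add: simple_tree_def)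
  let ?V = "pverts T" and ?E = "parcs T"
  have sym: "(y, x) \<in> ?E" if "(x, y) \<in> ?E" for x y
    using pair_sym_arcs that by (simp add: symmetric_def symD)
  have irr: "(x, x) \<notin> ?E" for x using pair_no_loops[of "(x, x)"] by auto
  have con: "(x, y) \<in> ?E\<^sup>*" if "x \<in> ?V" "y \<in> ?V" for x y
    using simple_tree_connected[OF assms that] .
  have no_cycle: False
    if "set p \<subseteq> ?E" "u \<in> ?V" "pcas u p u" "distinct (tl (pawalk_verts u p))" "3 \<le> length p" for p u
  proof -
    have "cycle p" using that by (auto simp: cycle_def awalk_def)
    then show False using assms that(5) by (auto simp: simple_tree_def)
  qed
  \<comment> \<open>Only induced subtrees are collected, so a member that covers all vertices
    carries all arcs.\<close>
  define A where "A = {S. S \<subseteq> ?V \<and> grown_tree S (?E \<inter> S \<times> S)}"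
  have "?V \<noteq> {}" using assms
    by (simp add: simple_tree_def Digraph_Component.connected_def strongly_connected_def)
  then obtain a where "a \<in> ?V" by blast
  moreover have "?E \<inter> {a} \<times> {a} = {}" using irr by blast
  ultimately have "{a} \<in> A" by (simp add: A_def grown_tree.single)
  moreover have "finite A" unfolding A_def using pair_finite_verts by simp
  ultimately obtain S where S: "S \<in> A" and max: "\<And>S'. S' \<in> A \<Longrightarrow> S \<subseteq> S' \<Longrightarrow> S = S'"
    using finite_has_maximal[of A] by blast
  then have SV: "S \<subseteq> ?V" and gr: "grown_tree S (?E \<inter> S \<times> S)" by (simp_all add: A_def)
  have "S = ?V"
  proof (rule ccontr)
    assume "S \<noteq> ?V"
    then obtain t where t: "t \<in> ?V" "t \<notin> S" using SV by blast
    obtain s where s: "s \<in> S" using grown_tree_nonempty[OF gr] by blast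
    have "(s, t) \<in> ?E\<^sup>*" using con s SV t by blast
    then have "t \<notin> S \<Longrightarrow> \<exists>b x. b \<in> S \<and> x \<notin> S \<and> (b, x) \<in> ?E"
      by (induction rule: rtrancl_induct) (use s in blast)+
    then obtain b x where bx: "b \<in> S" "x \<notin> S" "(b, x) \<in> ?E" using t by blast
    have xV: "x \<in> ?V" using bx(3) by (rule in_arcsD2)
    have uniq: "b' = b" if b': "b' \<in> S" "(x, b') \<in> ?E" for b'
    proof (rule ccontr)
      assume ne: "b' \<noteq> b"
      obtain p where p: "set p \<subseteq> ?E" "pcas b p b'" "distinct (pawalk_verts b p)"
          "set (pawalk_verts b p) \<subseteq> S"
        using grown_tree_apath[OF gr _ SV bx(1) b'(1)] unfolding apath_with_proj_iff by blast
      have pne: "p \<noteq> []" using p(2) ne by auto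
      \<comment> \<open>Two neighbours of \<open>x\<close> in \<open>S\<close> close a cycle through
        \<open>x\<close>. Since \<open>b' \<noteq> b\<close>, the path \<open>p\<close> is nonempty
        and the length reaches the 3 demanded in \<open>simple_tree\<close>.\<close>
      let ?c = "((x, b) # p) @ [(b', x)]"
      have "pcas x ((x, b) # p) (fst (b', x))" using p(2) by simp
      then have pv: "pawalk_verts x ?c = x # pawalk_verts b p @ [x]"
        by (subst pawalk_verts_snoc) simp_all
      show False
      proof (rule no_cycle)
        show "set ?c \<subseteq> ?E" using p(1) bx(3) b'(2) sym by auto
        show "x \<in> ?V" by (rule xV)
        show "pcas x ?c x" unfolding pcas_snoc using p(2) by simp
        show "distinct (tl (pawalk_verts x ?c))" unfolding pv using p(3,4) bx(2) by auto
        show "3 \<le> length ?c" using pne by (cases p) auto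
      qed
    qed
    have "grown_tree (insert x S) ((?E \<inter> S \<times> S) \<union> {(x, b), (b, x)})"
      using gr bx(1,2) by (rule grown_tree.add_leaf)
    moreover have "(?E \<inter> S \<times> S) \<union> {(x, b), (b, x)} = ?E \<inter> insert x S \<times> insert x S"
      using bx sym irr uniq by blast
    ultimately have "insert x S \<in> A" using SV xV by (simp add: A_def)
    then show False using max[of "insert x S"] bx(2) by blast
  qed
  moreover have "?E \<inter> ?V \<times> ?V = ?E" using in_arcsD1 in_arcsD2 by auto
  ultimately show ?thesis using gr by simp
qed

lemma harary_index_eq:
  assumes "simple_tree T"
  shows "harary_index T = harary2 (pverts T) (parcs T) / 2"
proof -
  interpret pair_graph T using assms by (simp add: simple_tree_def)
  have "path_dist T x y = rdist (parcs T) x y" if "x \<in> pverts T" "y \<in> pverts T" for x y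
    using that simple_tree_connected[OF assms] by (intro path_dist_eq_rdist pair_wf_digraph_axioms)
  then show ?thesis by (simp add: harary_index_def harary2_def recip_sum_def)
qed

section \<open>Isomorphisms of pair digraphs as bijections of vertices\<close>

text \<open>\<open>g\<close> runs from \<open>H\<close> to \<open>G\<close>, against the
  isomorphism, because it will be a labelling of the vertices of \<open>G\<close> by the numbers
  that form the spur.\<close>

lemma digraph_iso_pairI:
  assumes "pair_wf_digraph G" "bij_betw g (pverts H) (pverts G)" "parcs G = map_prod g g ` parcs H"
    and "parcs H \<subseteq> pverts H \<times> pverts H"
  shows "digraph_iso (with_proj G) (with_proj H)"
proof -
  interpret pair_wf_digraph G by (rule assms(1))
  define f where "f = the_inv_into (pverts H) g"
  have inj: "inj_on g (pverts H)" using assms(2) by (rule bij_betw_imp_inj_on)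
  have fg: "f (g i) = i" if "i \<in> pverts H" for i
    unfolding f_def using inj that by (rule the_inv_into_f_f)
  have bf: "bij_betw f (pverts G) (pverts H)" unfolding f_def using assms(2) by (rule bij_betw_the_inv_into)
  have fga: "map_prod f f (map_prod g g a) = a" if "a \<in> parcs H" for a
    using that assms(4) fg by (cases a) auto
  define hom where "hom = \<lparr>iso_verts = f, iso_arcs = map_prod f f, iso_head = snd, iso_tail = fst\<rparr>"
  have "inj_on (map_prod f f) (parcs G)"
    unfolding assms(3) by (rule inj_onI) (use fga in auto)
  then have "digraph_isomorphism hom"
    unfolding digraph_isomorphism_def hom_def
    using bf wf_digraph_axioms by (auto simp: bij_betw_def)
  moreover have "with_proj H = app_iso hom (with_proj G)"
  proof -
    have "map_prod f f ` parcs G = parcs H" unfolding assms(3) image_image using fga by simp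
    then show ?thesis using bf by (simp add: app_iso_def hom_def with_proj_def bij_betw_def)
  qed
  ultimately show ?thesis unfolding digraph_iso_def by blast
qed

text \<open>An arc of a pair digraph is the pair of its ends, so the vertex map of an isomorphism
  determines its arc map.\<close>

lemma digraph_iso_pairE:
  assumes "digraph_iso (with_proj G) (with_proj H)"
  obtains f where "bij_betw f (pverts G) (pverts H)" "parcs H = map_prod f f ` parcs G"
proof -
  obtain h where h: "pre_digraph.digraph_isomorphism (with_proj G) h" "with_proj H = app_iso h (with_proj G)"
    using assms by (auto simp: digraph_iso_def)
  have eqs: "pverts H = iso_verts h ` pverts G" "parcs H = iso_arcs h ` parcs G"
      "iso_tail h = fst" "iso_head h = snd"
    using h(2) by (simp_all add: app_iso_def with_proj_def)
  have "inj_on (iso_verts h) (pverts G)" and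
    "\<forall>a\<in>parcs G. iso_verts h (fst a) = fst (iso_arcs h a) \<and> iso_verts h (snd a) = snd (iso_arcs h a)"
    using h(1) eqs(3,4) by (auto simp: pre_digraph.digraph_isomorphism_def)
  then have "bij_betw (iso_verts h) (pverts G) (pverts H)"
    and "\<forall>a\<in>parcs G. iso_arcs h a = map_prod (iso_verts h) (iso_verts h) a"
    using eqs(1) by (auto simp: bij_betw_def prod_eq_iff)
  moreover from this(2) have "parcs H = map_prod (iso_verts h) (iso_verts h) ` parcs G"
    unfolding eqs(2) by (intro image_cong) auto
  ultimately show ?thesis using that by blast
qed

section \<open>The extremal trees\<close>

text \<open>\<open>x \<noteq> y\<close> excludes distance 0, where the convention
  \<open>1 / 0 = 0\<close> would break the inequality.\<close>

lemma inverse_rdist_ge: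
  assumes "(x, y) \<in> (E\<^sup>=) ^^ k" "x \<noteq> y"
  shows "1 / real k \<le> 1 / real (rdist E x y)"
proof -
  have "(x, y) \<in> (E\<^sup>=) ^^ rdist E x y" unfolding rdist_def using assms(1) by (rule LeastI)
  then have "rdist E x y \<noteq> 0" using assms(2) by (cases "rdist E x y = 0") auto
  moreover have "rdist E x y \<le> k" by (rule rdist_leI[OF assms(1)])
  ultimately show ?thesis by (intro frac_le) auto
qed

text \<open>Vertices of a spur: the centre \<open>c\<close>, its neighbours \<open>N\<close>, and the other vertices \<open>P\<close>, where
  \<open>x \<in> P\<close> hangs off \<open>p x \<in> N\<close>.\<close>

lemma harary2_spur_lower:
  fixes E :: "('a \<times> 'a) set"
  assumes fin: "finite N" "finite P" and dis: "c \<notin> N" "c \<notin> P" "N \<inter> P = {}"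
    and "sym E" and cN: "\<And>x. x \<in> N \<Longrightarrow> (c, x) \<in> E"
    and pN: "\<And>x. x \<in> P \<Longrightarrow> p x \<in> N" and pE: "\<And>x. x \<in> P \<Longrightarrow> (p x, x) \<in> E"
  defines "m \<equiv> real (card N)" and "k \<equiv> real (card P)"
  shows "2 * m + 3 * k + m * (m - 1) / 2 + 2 * k * (m - 1) / 3 + k * (k - 1) / 4
    \<le> harary2 (insert c (N \<union> P)) E"
proof -
  define q where "q x y = 1 / real (rdist E x y)" for x y
  define W where "W A B = (\<Sum>x\<in>A. \<Sum>y\<in>B. q x y)" for A B
  \<comment> \<open>\<open>1 / 0 = 0\<close>, so the diagonal may be included in the double sum\<close>
  have q0: "q x x = 0" for x
    using rdist_leI[where x = x and y = x and k = 0 and E = E] by (simp add: q_def)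
  have qsym: "q x y = q y x" for x y
    using rdist_sym[OF \<open>sym E\<close>] by (simp add: q_def)
  have swap: "W A B = W B A" for A B
    unfolding W_def by (subst sum.swap) (simp add: qsym)
  let ?V = "insert c (N \<union> P)"
  have finV: "finite ?V" using fin by simp
  have Usum: "(\<Sum>x\<in>?V. g x) = g c + (sum g N + sum g P)" for g :: "'a \<Rightarrow> real"
    using fin dis by (simp add: sum.union_disjoint)
  have "recip_sum ?V E x = (\<Sum>y\<in>?V. q x y)" if "x \<in> ?V" for x
    unfolding recip_sum_def q_def[symmetric] using sum.remove[OF finV that, of "q x"] q0 by simp
  then have "harary2 ?V E = (\<Sum>x\<in>?V. \<Sum>y\<in>?V. q x y)" by (simp add: harary2_def)
  also have "\<dots> = (W {c} N + W {c} P) + ((W N {c} + (W N N + W N P)) + (W P {c} + (W P N + W P P)))"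
    unfolding Usum by (simp add: W_def q0 sum.distrib)
  finally have H: "harary2 ?V E = 2 * W {c} N + 2 * W {c} P + W N N + 2 * W P N + W P P"
    using swap[of N "{c}"] swap[of P "{c}"] swap[of N P] by simp
  have R: "(x, y) \<in> E\<^sup>=" if "(x, y) \<in> E \<or> (y, x) \<in> E" for x y
    using that \<open>sym E\<close> by (auto dest: symD)
  have dcN: "(c, x) \<in> (E\<^sup>=) ^^ 1" "(x, c) \<in> (E\<^sup>=) ^^ 1" if "x \<in> N" for x
    using R[of c x] R[of x c] cN[OF that] by auto
  have dpP: "(p x, x) \<in> (E\<^sup>=) ^^ 1" "(x, p x) \<in> (E\<^sup>=) ^^ 1" if "x \<in> P" for x
    using R[of "p x" x] R[of x "p x"] pE[OF that] by auto
  have trans: "(x, z) \<in> (E\<^sup>=) ^^ (i + j)" if "(x, y) \<in> (E\<^sup>=) ^^ i" "(y, z) \<in> (E\<^sup>=) ^^ j" for x y z i j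
    using that unfolding relpow_add by blast
  have dcP: "(c, x) \<in> (E\<^sup>=) ^^ 2" "(x, c) \<in> (E\<^sup>=) ^^ 2" if "x \<in> P" for x
    using trans[OF dcN(1)[OF pN[OF that]] dpP(1)[OF that]] trans[OF dpP(2)[OF that] dcN(2)[OF pN[OF that]]]
    by (simp_all only: one_add_one)
  have dNN: "(x, y) \<in> (E\<^sup>=) ^^ 2" if "x \<in> N" "y \<in> N" for x y
    using trans[OF dcN(2)[OF that(1)] dcN(1)[OF that(2)]] by (simp only: one_add_one)
  have dPN: "(x, y) \<in> (E\<^sup>=) ^^ 3" if "x \<in> P" "y \<in> N" for x y
    using trans[OF dcP(2)[OF that(1)] dcN(1)[OF that(2)]] by simp
  have dPP: "(x, y) \<in> (E\<^sup>=) ^^ 4" if "x \<in> P" "y \<in> P" for x y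
    using trans[OF dcP(2)[OF that(1)] dcP(1)[OF that(2)]] by simp
  have q: "1 / real j \<le> q x y" if "(x, y) \<in> (E\<^sup>=) ^^ j" "x \<noteq> y" for x y j
    unfolding q_def using that by (rule inverse_rdist_ge)
  have lower: "real (card A) * b \<le> sum g A" if "\<And>x. x \<in> A \<Longrightarrow> b \<le> g x" for A b and g :: "'a \<Rightarrow> real"
    using sum_bounded_below[of A b g] that by simp
  have cA: "real (card (A - {x})) = real (card A) - 1" if "finite A" "x \<in> A" for A and x :: 'a
    using card.remove[OF that] by simp
  have 1: "m \<le> W {c} N"
  proof -
    have "m * 1 \<le> (\<Sum>y\<in>N. q c y)" unfolding m_def
      using q[OF dcN(1)] dis by (intro lower) fastforce
    then show ?thesis by (simp add: W_def)
  qed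
  have 2: "k / 2 \<le> W {c} P"
  proof -
    have "k * (1 / 2) \<le> (\<Sum>y\<in>P. q c y)" unfolding k_def
      using q[OF dcP(1)] dis by (intro lower) fastforce
    then show ?thesis by (simp add: W_def)
  qed
  have 3: "m * ((m - 1) / 2) \<le> W N N" unfolding W_def m_def
  proof (rule lower)
    fix x assume x: "x \<in> N"
    have "real (card (N - {x})) * (1 / 2) \<le> (\<Sum>y\<in>N - {x}. q x y)"
    proof (rule lower)
      fix y assume "y \<in> N - {x}"
      then show "1 / 2 \<le> q x y" using q[OF dNN[OF x, of y]] by auto
    qed
    then show "(real (card N) - 1) / 2 \<le> (\<Sum>y\<in>N. q x y)"
      using sum.remove[OF fin(1) x, of "q x"] cA[OF fin(1) x] q0 by simp
  qed
  have 4: "k * ((k - 1) / 4) \<le> W P P" unfolding W_def k_def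
  proof (rule lower)
    fix x assume x: "x \<in> P"
    have "real (card (P - {x})) * (1 / 4) \<le> (\<Sum>y\<in>P - {x}. q x y)"
    proof (rule lower)
      fix y assume "y \<in> P - {x}"
      then show "1 / 4 \<le> q x y" using q[OF dPP[OF x, of y]] by auto
    qed
    then show "(real (card P) - 1) / 4 \<le> (\<Sum>y\<in>P. q x y)"
      using sum.remove[OF fin(2) x, of "q x"] cA[OF fin(2) x] q0 by simp
  qed
  \<comment> \<open>Each \<open>x\<close> in \<open>P\<close> has its parent at distance 1 and the
    other \<open>m - 1\<close> vertices of \<open>N\<close> within distance 3.\<close>
  have 5: "k * (1 + (m - 1) / 3) \<le> W P N" unfolding W_def k_def
  proof (rule lower)
    fix x assume x: "x \<in> P"
    have "real (card (N - {p x})) * (1 / 3) \<le> (\<Sum>y\<in>N - {p x}. q x y)"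
    proof (rule lower)
      fix y assume "y \<in> N - {p x}"
      then show "1 / 3 \<le> q x y" using q[OF dPN[OF x, of y]] x dis by auto
    qed
    moreover have "1 \<le> q x (p x)"
    proof -
      have "x \<noteq> p x" using x pN[OF x] dis(3) by (metis IntI empty_iff)
      then show ?thesis using q[OF dpP(2)[OF x]] by simp
    qed
    ultimately show "1 + (m - 1) / 3 \<le> (\<Sum>y\<in>N. q x y)"
      using sum.remove[OF fin(1) pN[OF x], of "q x"] cA[OF fin(1) pN[OF x]] unfolding m_def by argo
  qed
  \<comment> \<open>\<open>3 * k\<close> collects, in both orders, the pairs of a vertex of
    \<open>P\<close> with the centre (1/2 each) and with its parent (1 each).\<close>
  have "2 * m + 3 * k + m * (m - 1) / 2 + 2 * k * (m - 1) / 3 + k * (k - 1) / 4 =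
     2 * m + 2 * (k / 2) + m * ((m - 1) / 2) + 2 * (k * (1 + (m - 1) / 3)) + k * ((k - 1) / 4)"
    by (simp add: field_simps)
  then show ?thesis unfolding H using 1 2 3 4 5 by argo
qed

section \<open>Graphs isomorphic to the spur attain the bound\<close>

lemma spur_parcs:
  "parcs (spur n m) =
    {(0, i) | i. 1 \<le> i \<and> i \<le> m} \<union> {(i, m + i) | i. 1 \<le> i \<and> i \<le> n - m - 1} \<union>
    ({(0, i) | i. 1 \<le> i \<and> i \<le> m} \<union> {(i, m + i) | i. 1 \<le> i \<and> i \<le> n - m - 1})\<inverse>"
  by (simp add: spur_def Let_def)

lemma spur_pverts: "pverts (spur n m) = {0..<n}"
  by (simp add: spur_def Let_def)

lemma max_matching_pos:
  assumes "finite E" "(x, y) \<in> E"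
  shows "1 \<le> max_matching E"
proof -
  have "{{x, y}} \<in> matchings E" by (rule matchingsI) (use assms(2) in blast)+
  then show ?thesis using card_matching_le[OF assms(1)] by fastforce
qed

text \<open>The inverse isomorphism carries the labels of the spur to \<open>G\<close>;
  \<open>harary2_spur_lower\<close> then applies with n - \<beta> neighbours of the centre and
  \<beta> - 1 further vertices.\<close>

lemma harary2_lower:
  assumes T: "grown_tree (pverts G) (parcs G)" and n: "card (pverts G) = n" "2 \<le> n"
    and b: "max_matching (parcs G) = b"
    and iso: "digraph_iso (with_proj G) (with_proj (spur n (n - b)))"
  shows "harary_bound n b \<le> harary2 (pverts G) (parcs G)"
proof -
  obtain f where f: "bij_betw f (pverts G) {0..<n}"
      "parcs (spur n (n - b)) = map_prod f f ` parcs G"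
    using iso by (rule digraph_iso_pairE) (simp add: spur_pverts)
  have "card (parcs G) \<noteq> 0" using grown_tree_card_edges[OF T] n by simp
  then obtain x y where "(x, y) \<in> parcs G" by (metis card.empty equals0I surj_pair)
  then have b1: "1 \<le> b" using max_matching_pos[OF grown_tree_finite_edges[OF T]] b by metis
  have b2: "2 * b \<le> n" using matching_twice_le[OF T] n b by simp
  define m k where "m = n - b" and "k = b - 1"
  have mk: "n = Suc (m + k)" "k \<le> m" "n - m - 1 = k" using b1 b2 by (simp_all add: m_def k_def)
  define g where "g = the_inv_into (pverts G) f"
  have bg: "bij_betw g {0..<n} (pverts G)" unfolding g_def using f(1) by (rule bij_betw_the_inv_into)
  have gi: "inj_on g {0..<n}" using bg by (rule bij_betw_imp_inj_on)
  have fg: "f (g i) = i" if "i < n" for i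
    unfolding g_def using f(1) that by (intro f_the_inv_into_f_bij_betw) auto
  have gf: "g (f x) = x" if "x \<in> pverts G" for x
    unfolding g_def using f(1) that by (intro the_inv_into_f_f bij_betw_imp_inj_on)
  have E: "(g i, g j) \<in> parcs G" if ij: "(i, j) \<in> parcs (spur n m)" for i j
  proof -
    obtain x y where xy: "(x, y) \<in> parcs G" "i = f x" "j = f y" using ij f(2) by (auto simp: m_def)
    then show ?thesis using gf grown_tree_edgeD[OF T xy(1)] by simp
  qed
  define N P where "N = g ` {1..m}" and "P = g ` {Suc m..m + k}"
  \<comment> \<open>The vertex labelled \<open>m + j\<close> hangs off the one labelled
    \<open>j\<close>.\<close>
  define p where "p x = g (f x - m)" for x
  have sub: "{1..m} \<subseteq> {0..<n}" "{Suc m..m + k} \<subseteq> {0..<n}" "0 \<in> {0..<n}" using mk by auto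
  have cN: "card N = m" unfolding N_def using card_image[OF inj_on_subset[OF gi sub(1)]] by simp
  have cP: "card P = k" unfolding P_def using card_image[OF inj_on_subset[OF gi sub(2)]] by simp
  have V: "insert (g 0) (N \<union> P) = pverts G"
  proof -
    have "insert 0 ({1..m} \<union> {Suc m..m + k}) = {0..<n}" using mk by auto
    moreover have "insert (g 0) (N \<union> P) = g ` insert 0 ({1..m} \<union> {Suc m..m + k})"
      unfolding N_def P_def by blast
    ultimately show ?thesis using bg by (simp add: bij_betw_def)
  qed
  have dis: "g 0 \<notin> N" "g 0 \<notin> P" "N \<inter> P = {}"
  proof -
    have eq: "i = j" if "g i = g j" "i < n" "j < n" for i j using inj_onD[OF gi that(1)] that by simp
    show "g 0 \<notin> N" "g 0 \<notin> P" unfolding N_def P_def using eq[of 0] mk(1) by fastforce+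
    show "N \<inter> P = {}" unfolding N_def P_def using eq mk(1) by fastforce
  qed
  have p: "p x \<in> N \<and> (p x, x) \<in> parcs G" if "x \<in> P" for x
  proof -
    obtain j where j: "x = g (m + j)" "1 \<le> j" "j \<le> k"
    proof -
      from \<open>x \<in> P\<close> obtain i where i: "x = g i" "Suc m \<le> i" "i \<le> m + k" unfolding P_def by auto
      then show ?thesis by (intro that[of "i - m"]) auto
    qed
    then have "p x = g j" using fg[of "m + j"] mk by (simp add: p_def)
    moreover have "g j \<in> N" unfolding N_def using j mk by auto
    moreover have "(g j, g (m + j)) \<in> parcs G" using j mk by (intro E) (auto simp: spur_parcs)
    ultimately show ?thesis using j by simp
  qed
  have "(g 0, x) \<in> parcs G" if "x \<in> N" for x
    using that unfolding N_def by (auto intro!: E simp: spur_parcs)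
  then have low: "2 * real m + 3 * real k + real m * (real m - 1) / 2 + 2 * real k * (real m - 1) / 3
      + real k * (real k - 1) / 4 \<le> harary2 (pverts G) (parcs G)"
    using harary2_spur_lower[of N P "g 0" "parcs G" p] dis p grown_tree_sym[OF T] cN cP
    unfolding V by (simp add: N_def P_def)
  have "real n = real m + real k + 1" "real b = real k + 1" using mk b1 by (simp_all add: k_def)
  \<comment> \<open>Under \<open>n = m + k + 1\<close> and \<open>b = k + 1\<close> the bound
    becomes the sum over the pairs of a spur.\<close>
  then have "harary_bound n b = 2 * real m + 3 * real k + real m * (real m - 1) / 2
      + 2 * real k * (real m - 1) / 3 + real k * (real k - 1) / 4"
    by (simp add: harary_bound_def field_simps power2_eq_square)
  then show ?thesis using low by simp
qed

text \<open>The centre and the parents of the vertices at distance 2 form a vertex cover, so the matching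
  number forces these parents to be distinct.\<close>

lemma spur_of_centre:
  assumes T: "grown_tree (pverts G) (parcs G)" and wf: "pair_wf_digraph G"
    and n: "card (pverts G) = n" "2 \<le> n" and b: "max_matching (parcs G) = b"
    and c: "c \<in> pverts G" "card (parcs G `` {c}) + b = n"
    and ball: "\<And>x. x \<in> pverts G \<Longrightarrow> (c, x) \<in> ((parcs G)\<^sup>=) ^^ 2"
  shows "digraph_iso (with_proj G) (with_proj (spur n (n - b)))"
proof -
  let ?V = "pverts G" and ?E = "parcs G"
  define N P where "N = ?E `` {c}" and "P = ?V - insert c N"
  define m k where "m = n - b" and "k = card P"
  have fin: "finite ?V" and finE: "finite ?E"
    using grown_tree_finite[OF T] grown_tree_finite_edges[OF T] .
  have NV: "N \<subseteq> ?V" unfolding N_def using grown_tree_edgeD[OF T] by blast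
  have cN: "c \<notin> N" unfolding N_def using grown_tree_irrefl[OF T] by blast
  have finN: "finite N" and finP: "finite P" using NV fin finite_subset unfolding P_def by auto
  have dis: "c \<notin> P" "N \<inter> P = {}" by (auto simp: P_def)
  have V: "?V = insert c (N \<union> P)" using NV c(1) by (auto simp: P_def)
  have cardN: "card N = m" using c(2) by (simp add: N_def m_def)
  have nmk: "n = Suc (m + k)"
  proof -
    have "card ?V = Suc (card (N \<union> P))" unfolding V using cN dis(1) finN finP by simp
    also have "card (N \<union> P) = card N + card P" using finN finP dis(2) by (rule card_Un_disjoint)
    finally show ?thesis using n cardN by (simp add: k_def)
  qed
  have bk: "b = Suc k" using nmk c(2) cardN by (simp add: N_def)
  have "\<exists>y. y \<in> N \<and> (y, x) \<in> ?E" if x: "x \<in> P" for x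
  proof -
    have "x \<in> ?V" "x \<noteq> c" "(c, x) \<notin> ?E" using x by (auto simp: P_def N_def)
    then show ?thesis using ball[of x] unfolding refl_relpow_2 N_def by blast
  qed
  then obtain p where p: "\<And>x. x \<in> P \<Longrightarrow> p x \<in> N \<and> (p x, x) \<in> ?E" by metis
  \<comment> \<open>The arcs pointing away from \<open>c\<close>. With their converses they number 2
    (n - 1), the size of \<open>?E\<close>, so there are no others.\<close>
  define A where "A = Pair c ` N \<union> (\<lambda>x. (p x, x)) ` P"
  have finA: "finite A" unfolding A_def using finN finP by simp
  have AE: "A \<subseteq> ?E" unfolding A_def N_def using p by (auto simp: N_def)
  then have AE': "A \<union> A\<inverse> \<subseteq> ?E" using grown_tree_symD[OF T] by blast
  have cardA: "card A = m + k"
  proof -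
    have "card A = card (Pair c ` N) + card ((\<lambda>x. (p x, x)) ` P)"
      unfolding A_def using finN finP p cN by (intro card_Un_disjoint) auto
    moreover have "card (Pair c ` N) = m" using cardN by (subst card_image) (auto intro: inj_onI)
    moreover have "card ((\<lambda>x. (p x, x)) ` P) = k" unfolding k_def by (subst card_image) (auto intro: inj_onI)
    ultimately show ?thesis by simp
  qed
  have "A \<inter> A\<inverse> = {}" unfolding A_def using cN dis p by auto
  then have "card (A \<union> A\<inverse>) = 2 * (m + k)" using cardA finA by (subst card_Un_disjoint) simp_all
  then have "card (A \<union> A\<inverse>) = card ?E" using grown_tree_card_edges[OF T] n nmk by simp
  then have E: "?E = A \<union> A\<inverse>" using card_subset_eq[OF finE AE'] by simp
  have inj: "inj_on p P"
  proof -
    have "b \<le> card (insert c (p ` P))" unfolding b[symmetric]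
    proof (rule max_matching_le_cover[OF finE])
      fix x y assume "(x, y) \<in> ?E"
      then show "x \<in> insert c (p ` P) \<or> y \<in> insert c (p ` P)" unfolding E A_def by auto
    qed (use finP in simp)
    also have "\<dots> \<le> Suc (card (p ` P))" using finP by (simp add: card_insert_if)
    finally have "card P \<le> card (p ` P)" using bk by (simp add: k_def)
    then have "card (p ` P) = card P" using card_image_le[OF finP] by (rule antisym[rotated])
    then show ?thesis by (rule eq_card_imp_inj_on[OF finP])
  qed
  have pP: "p ` P \<subseteq> N" using p by blast
  have km: "k \<le> m" using card_mono[OF finN pP] card_image[OF inj] cardN by (simp add: k_def)
  obtain e where e: "bij_betw e {1..k} P"
    using finite_same_card_bij[of "{1..k}" P] finP by (auto simp: k_def)
  have "card {Suc k..m} = card (N - p ` P)"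
    using card_Diff_subset[OF finite_subset[OF pP finN] pP] card_image[OF inj] cardN by (simp add: k_def)
  then obtain h where h: "bij_betw h {Suc k..m} (N - p ` P)"
    using finite_same_card_bij[of "{Suc k..m}" "N - p ` P"] finN by auto
  \<comment> \<open>Labels as in \<open>spur\<close>: parents of vertices of \<open>P\<close> get 1
    to \<open>k\<close>, childless neighbours of \<open>c\<close> get \<open>k + 1\<close> to
    \<open>m\<close>, and the child of the vertex labelled \<open>i\<close> gets
    \<open>m + i\<close>.\<close>
  define g where "g i = (if i = 0 then c else if i \<le> k then p (e i) else if i \<le> m then h i else e (i - m))"
    for i
  have g1: "bij_betw g {1..k} (p ` P)"
  proof -
    have "bij_betw (p \<circ> e) {1..k} (p ` P)"
      using e inj by (rule bij_betw_trans[OF _ inj_on_imp_bij_betw])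
    then show ?thesis by (rule bij_betw_cong[THEN iffD1, rotated]) (simp add: g_def)
  qed
  have g2: "bij_betw g {Suc k..m} (N - p ` P)"
    using h by (rule bij_betw_cong[THEN iffD1, rotated]) (simp add: g_def)
  have g3: "bij_betw g {Suc m..m + k} P"
  proof -
    have "bij_betw (\<lambda>i. i - m) {Suc m..m + k} {1..k}"
      by (rule bij_betwI[where g = "\<lambda>i. m + i"]) auto
    then have "bij_betw (e \<circ> (\<lambda>i. i - m)) {Suc m..m + k} P" using e by (rule bij_betw_trans)
    then show ?thesis by (rule bij_betw_cong[THEN iffD1, rotated]) (use km in \<open>auto simp: g_def\<close>)
  qed
  have g12: "bij_betw g {1..m} N"
  proof -
    have "bij_betw g ({1..k} \<union> {Suc k..m}) (p ` P \<union> (N - p ` P))"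
      using g1 g2 by (rule bij_betw_combine) blast
    moreover have "{1..k} \<union> {Suc k..m} = {1..m}" using km by auto
    moreover have "p ` P \<union> (N - p ` P) = N" using pP by blast
    ultimately show ?thesis by simp
  qed
  have "bij_betw g {0..<n} ?V"
  proof -
    have "bij_betw g {0} {c}" by (simp add: g_def bij_betw_def)
    moreover have "bij_betw g ({1..m} \<union> {Suc m..m + k}) (N \<union> P)"
      using g12 g3 dis(2) by (rule bij_betw_combine)
    ultimately have "bij_betw g ({0} \<union> ({1..m} \<union> {Suc m..m + k})) ({c} \<union> (N \<union> P))"
      by (rule bij_betw_combine) (use cN dis(1) in blast)
    moreover have "{0} \<union> ({1..m} \<union> {Suc m..m + k}) = {0..<n}" using nmk by auto
    ultimately show ?thesis using V by simp
  qed
  moreover have "?E = map_prod g g ` parcs (spur n m)"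
  proof -
    have 1: "map_prod g g ` {(0, i) | i. 1 \<le> i \<and> i \<le> m} = Pair c ` N"
    proof -
      have "{(0::nat, i) | i. 1 \<le> i \<and> i \<le> m} = Pair 0 ` {1..m}" by auto
      moreover have "N = g ` {1..m}" using g12 by (simp add: bij_betw_def)
      ultimately show ?thesis by (simp add: image_image g_def[of 0])
    qed
    have 2: "map_prod g g ` {(i, m + i) | i. 1 \<le> i \<and> i \<le> n - m - 1} = (\<lambda>x. (p x, x)) ` P"
    proof -
      have "{(i, m + i) | i. 1 \<le> i \<and> i \<le> n - m - 1} = (\<lambda>i. (i, m + i)) ` {1..k}" using nmk by auto
      moreover have "P = e ` {1..k}" using e by (simp add: bij_betw_def)
      moreover have "g i = p (e i)" "g (m + i) = e i" if "i \<in> {1..k}" for i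
        using that km by (auto simp: g_def)
      ultimately show ?thesis by (auto simp: image_image)
    qed
    have conv: "map_prod g g ` (B\<inverse>) = (map_prod g g ` B)\<inverse>" for B by force
    show ?thesis unfolding spur_parcs image_Un conv 1 2 E A_def ..
  qed
  moreover have "parcs (spur n m) \<subseteq> {0..<n} \<times> {0..<n}"
    unfolding spur_parcs using nmk km by auto
  ultimately show ?thesis using wf unfolding m_def
    by (intro digraph_iso_pairI[where g = g]) (simp_all add: spur_pverts)
qed

theorem theorem3p4:
  fixes T :: "'a pair_pre_digraph" and n \<beta> :: nat
  assumes "simple_tree T"
    and "card (pverts T) = n"
    and "n \<ge> 2"
    and "matching_number T = \<beta>"
  shows "harary_index T \<le>
           1 / 24 * (6 * (real n)\<^sup>2 - 4 * real \<beta> * real n + (real \<beta>)\<^sup>2 + 9 * real \<beta> + 10 * real n - 22)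
         \<and> (harary_index T =
              1 / 24 * (6 * (real n)\<^sup>2 - 4 * real \<beta> * real n + (real \<beta>)\<^sup>2 + 9 * real \<beta> + 10 * real n - 22)
            \<longleftrightarrow> digraph_iso (with_proj T) (with_proj (spur n (n - \<beta>))))"
proof -
  interpret pair_graph T using assms(1) by (simp add: simple_tree_def)
  let ?H = "harary2 (pverts T) (parcs T)"
  have gr: "grown_tree (pverts T) (parcs T)" by (rule simple_tree_grown[OF assms(1)])
  have m: "max_matching (parcs T) = \<beta>" using assms(4) by (simp add: matching_number_eq)
  have up: "?H \<le> harary_bound n \<beta>"
    and ex: "?H = harary_bound n \<beta> \<Longrightarrow> \<exists>c\<in>pverts T. card (parcs T `` {c}) + \<beta> = n \<and>
      (\<forall>x\<in>pverts T. (c, x) \<in> ((parcs T)\<^sup>=) ^^ 2)"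
    using harary2_upper[OF gr] assms(2,3) m by auto
  have "?H = harary_bound n \<beta> \<longleftrightarrow> digraph_iso (with_proj T) (with_proj (spur n (n - \<beta>)))"
  proof
    assume "?H = harary_bound n \<beta>"
    from ex[OF this] obtain c where "c \<in> pverts T" "card (parcs T `` {c}) + \<beta> = n"
        "\<forall>x\<in>pverts T. (c, x) \<in> ((parcs T)\<^sup>=) ^^ 2" by blast
    then show "digraph_iso (with_proj T) (with_proj (spur n (n - \<beta>)))"
      by (intro spur_of_centre[OF gr pair_wf_digraph_axioms assms(2,3) m]) auto
  next
    assume "digraph_iso (with_proj T) (with_proj (spur n (n - \<beta>)))"
    from harary2_lower[OF gr assms(2,3) m this] up show "?H = harary_bound n \<beta>" by simp
  qed
  moreover have h: "harary_index T = ?H / 2" by (rule harary_index_eq[OF assms(1)])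
  moreover have F: "1 / 24 * (6 * (real n)\<^sup>2 - 4 * real \<beta> * real n + (real \<beta>)\<^sup>2 + 9 * real \<beta> + 10 * real n - 22)
      = harary_bound n \<beta> / 2"
    by (simp add: harary_bound_def)
  ultimately show ?thesis using up unfolding F h by simp
qed

end
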